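(* Let $p$ be an odd prime and let $G$ be a $p$-group of order $p^m$ of rank $5$ with $G\in\Phi_6$. Then (1) $\displaystyle A_G(t/|G|)=\frac{1-p^{-3}}{1-p^{-2}t} + \frac{p^{-3}}{1-t}$; (2) $\displaystyle B_G(t/|G|)=\frac{-p^{-1}-p^{-2}}{1-p^{-3}t} + \frac{1+p^{-1}+p^{-2}}{1-p^{-2}t}$.
   Context: For a finite group $G$ and $n\ge 0$, $\alpha_{G,n}$ denotes the number of orbits of $G$ acting on $G^n$ by simultaneous conjugation $g\cdot(x_1,\dots,x_n)=(gx_1g^{-1},\dots,gx_ng^{-1})$, and $\beta_{G,n}$ denotes the number of orbits of the same action on the set $G^{(n)}$ of $n$-tuples of pairwise commuting elements of $G$; $\alpha_{G,0}=\beta_{G,0}=1$. Set $A_G(t)=\sum_{n\ge 0}\alpha_{G,n}t^n$ and $B_G(t)=\sum_{n\ge 0}\beta_{G,n}t^n$ (formal power series, which are rational functions of $t$). $A_G(t/|G|)$, $B_G(t/|G|)$ denote the result of substituting $t/|G|$ for $t$. Finite groups $G,H$ are isoclinic if there are isomorphisms $\theta:G/Z(G)\to H/Z(H)$ and $\phi:G'\to H'$ (derived subgroups) such that $\phi([g_1,g_2])=[h_1,h_2]$ whenever $\theta(g_iZ(G))=h_iZ(H)$ for $i=1,2$. Isoclinism is an equivalence relation, whose classes are called isoclinism families. For a $p$-group $G$, the rank of (the family of) $G$ is the smallest $r$ such that the isoclinism family of $G$ contains a group of order $p^r$. $\Phi_6$ (James's notation) is the isoclinism family, of rank 5, of the group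 of order $p^5$ $$\Phi_6(1^5)=\langle \alpha_1, \alpha_2, \beta, \beta_1, \beta_2\mid[\alpha_1,\alpha_2]=\beta,\ [\beta, \alpha_i]=\beta_i,\ \alpha_i^p=\beta^p=\beta_i^p=1\ (i=1,2) \rangle .$$ Here $[x,y]=x^{-1}y^{-1}xy$, and by convention all pairs of generators whose commutator is not listed commute. $G\in\Phi_6$ means $G$ is a finite $p$-group isoclinic to this group. *)

theory Defs
  imports
    "HOL-Algebra.Group_Action"
    "HOL-Algebra.Generated_Groups"
    "HOL-Computational_Algebra.Primes"
    "HOL-Computational_Algebra.Formal_Power_Series"
begin

section \<open>Orbits of tuples under simultaneous conjugation\<close>

text \<open>The set \<open>G\<^sup>n\<close> is modelled by the lists of length \<open>n\<close> over the carrier; for \<open>n = 0\<close> both sets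
  below are \<open>{[]}\<close>, so both orbit numbers are 1.\<close>

definition tuples :: "('a, 'b) monoid_scheme \<Rightarrow> nat \<Rightarrow> 'a list set" where
  "tuples G n = {xs. length xs = n \<and> set xs \<subseteq> carrier G}"

definition commuting_tuples :: "('a, 'b) monoid_scheme \<Rightarrow> nat \<Rightarrow> 'a list set" where
  "commuting_tuples G n =
     {xs \<in> tuples G n. \<forall>x\<in>set xs. \<forall>y\<in>set xs. x \<otimes>\<^bsub>G\<^esub> y = y \<otimes>\<^bsub>G\<^esub> x}"

definition conj_act :: "('a, 'b) monoid_scheme \<Rightarrow> 'a \<Rightarrow> 'a list \<Rightarrow> 'a list" where
  "conj_act G g = map (\<lambda>x. g \<otimes>\<^bsub>G\<^esub> x \<otimes>\<^bsub>G\<^esub> inv\<^bsub>G\<^esub> g)"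

definition alpha :: "('a, 'b) monoid_scheme \<Rightarrow> nat \<Rightarrow> nat" where
  "alpha G n = card (orbits G (tuples G n) (conj_act G))"

definition beta :: "('a, 'b) monoid_scheme \<Rightarrow> nat \<Rightarrow> nat" where
  "beta G n = card (orbits G (commuting_tuples G n) (conj_act G))"

definition A_series :: "('a, 'b) monoid_scheme \<Rightarrow> rat fps" where
  "A_series G = Abs_fps (\<lambda>n. of_nat (alpha G n))"

definition B_series :: "('a, 'b) monoid_scheme \<Rightarrow> rat fps" where
  "B_series G = Abs_fps (\<lambda>n. of_nat (beta G n))"


section \<open>Isoclinism\<close>

definition center :: "('a, 'b) monoid_scheme \<Rightarrow> 'a set" where
  "center G = {z \<in> carrier G. \<forall>x\<in>carrier G. z \<otimes>\<^bsub>G\<^esub> x = x \<otimes>\<^bsub>G\<^esub> z}"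

definition commutator :: "('a, 'b) monoid_scheme \<Rightarrow> 'a \<Rightarrow> 'a \<Rightarrow> 'a" where
  "commutator G x y = inv\<^bsub>G\<^esub> x \<otimes>\<^bsub>G\<^esub> inv\<^bsub>G\<^esub> y \<otimes>\<^bsub>G\<^esub> x \<otimes>\<^bsub>G\<^esub> y"

text \<open>The library's \<^const>\<open>derived\<close> is generated by the elements \<open>x y x\<^sup>-\<^sup>1 y\<^sup>-\<^sup>1\<close>; over a whole
  group this is the same set of generators as the commutators above.\<close>

abbreviation derived_group :: "('a, 'b) monoid_scheme \<Rightarrow> ('a, 'b) monoid_scheme" where
  "derived_group G \<equiv> G\<lparr>carrier := derived G (carrier G)\<rparr>"

definition isoclinic :: "('a, 'b) monoid_scheme \<Rightarrow> ('c, 'd) monoid_scheme \<Rightarrow> bool" where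
  "isoclinic G H \<longleftrightarrow>
     (\<exists>\<theta> \<in> iso (G Mod center G) (H Mod center H).
      \<exists>\<phi> \<in> iso (derived_group G) (derived_group H).
        \<forall>g1\<in>carrier G. \<forall>g2\<in>carrier G. \<forall>h1\<in>carrier H. \<forall>h2\<in>carrier H.
          \<theta> (center G #>\<^bsub>G\<^esub> g1) = center H #>\<^bsub>H\<^esub> h1 \<longrightarrow>
          \<theta> (center G #>\<^bsub>G\<^esub> g2) = center H #>\<^bsub>H\<^esub> h2 \<longrightarrow>
          \<phi> (commutator G g1 g2) = commutator H h1 h2)"

text \<open>Every finite group is isomorphic to one whose elements are natural numbers, so it is enough
  to let \<open>H\<close> range over those.\<close>

definition isoclinism_rank :: "nat \<Rightarrow> ('a, 'b) monoid_scheme \<Rightarrow> nat" where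
  "isoclinism_rank p G =
     (LEAST r. \<exists>H :: nat monoid. group H \<and> order H = p ^ r \<and> isoclinic G H)"


section \<open>Groups given by generators and relations\<close>

text \<open>The generators are all the elements of the type \<^typ>\<open>'g\<close>. A letter \<open>(True, x)\<close> stands for
  \<open>x\<close> and \<open>(False, x)\<close> for its inverse. A pair \<open>(u, v)\<close> in \<open>R\<close> is the relation \<open>u = v\<close>.\<close>

type_synonym 'g word = "(bool \<times> 'g) list"

definition gen :: "'g \<Rightarrow> 'g word" where
  "gen x = [(True, x)]"

definition word_inv :: "'g word \<Rightarrow> 'g word" where
  "word_inv w = rev (map (\<lambda>(e, x). (\<not> e, x)) w)"

definition word_comm :: "'g word \<Rightarrow> 'g word \<Rightarrow> 'g word" where
  "word_comm u v = word_inv u @ word_inv v @ u @ v"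

definition word_pow :: "'g word \<Rightarrow> nat \<Rightarrow> 'g word" where
  "word_pow w n = concat (replicate n w)"

inductive pres_eq :: "('g word \<times> 'g word) set \<Rightarrow> 'g word \<Rightarrow> 'g word \<Rightarrow> bool"
  for R :: "('g word \<times> 'g word) set" where
  refl: "pres_eq R u u"
| sym: "pres_eq R u v \<Longrightarrow> pres_eq R v u"
| trans: "pres_eq R u v \<Longrightarrow> pres_eq R v w \<Longrightarrow> pres_eq R u w"
| mult: "pres_eq R u u' \<Longrightarrow> pres_eq R v v' \<Longrightarrow> pres_eq R (u @ v) (u' @ v')"
| cancel: "pres_eq R [(e, x), (\<not> e, x)] []"
| rel: "(u, v) \<in> R \<Longrightarrow> pres_eq R u v"

definition pres_class :: "('g word \<times> 'g word) set \<Rightarrow> 'g word \<Rightarrow> 'g word set" where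
  "pres_class R u = {v. pres_eq R u v}"

definition presented_group :: "('g word \<times> 'g word) set \<Rightarrow> 'g word set monoid" where
  "presented_group R =
     \<lparr>carrier = range (pres_class R),
      monoid.mult = (\<lambda>U V. \<Union>u\<in>U. \<Union>v\<in>V. pres_class R (u @ v)),
      one = pres_class R []\<rparr>"

lemma pres_class_eq_iff: "pres_class R u = pres_class R v \<longleftrightarrow> pres_eq R u v"
proof
  assume "pres_class R u = pres_class R v"
  then have "v \<in> pres_class R u"
    by (simp add: pres_class_def pres_eq.refl)
  then show "pres_eq R u v"
    by (simp add: pres_class_def)
next
  assume "pres_eq R u v"
  then have "pres_eq R u w \<longleftrightarrow> pres_eq R v w" for w
    using pres_eq.trans[of R u v w] pres_eq.trans[of R v u w] pres_eq.sym[of R u v] by iprover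
  then show "pres_class R u = pres_class R v"
    by (simp add: pres_class_def)
qed

lemma mult_pres_class [simp]:
  "pres_class R u \<otimes>\<^bsub>presented_group R\<^esub> pres_class R v = pres_class R (u @ v)"
proof -
  have "pres_class R (u' @ v') = pres_class R (u @ v)"
    if "u' \<in> pres_class R u" "v' \<in> pres_class R v" for u' v'
    using that by (simp add: pres_class_eq_iff) (simp add: pres_class_def pres_eq.mult pres_eq.sym)
  then have "(\<Union>u'\<in>pres_class R u. \<Union>v'\<in>pres_class R v. pres_class R (u' @ v'))
      = (\<Union>u'\<in>pres_class R u. \<Union>v'\<in>pres_class R v. pres_class R (u @ v))"
    by (intro SUP_cong HOL.refl) simp_all
  moreover have "pres_class R u \<noteq> {}" "pres_class R v \<noteq> {}"
    using pres_eq.refl[of R] by (auto simp: pres_class_def)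
  ultimately show ?thesis
    by (simp add: presented_group_def)
qed

lemma pres_eq_word_inv: "pres_eq R (word_inv w @ w) []"
proof (induction w)
  case Nil
  show ?case by (simp add: word_inv_def pres_eq.refl)
next
  case (Cons a w)
  obtain e x where a: "a = (e, x)" by (cases a)
  have "pres_eq R [(\<not> e, x), (e, x)] []"
    using pres_eq.cancel[of R "\<not> e" x] by simp
  then have "pres_eq R (word_inv w @ [(\<not> e, x), (e, x)] @ w) (word_inv w @ [] @ w)"
    by (rule pres_eq.mult[OF pres_eq.refl pres_eq.mult[OF _ pres_eq.refl]])
  then have "pres_eq R (word_inv (a # w) @ a # w) (word_inv w @ w)"
    by (simp add: word_inv_def a)
  then show ?case
    using Cons.IH by (rule pres_eq.trans)
qed

lemma group_presented_group: "group (presented_group R)"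
proof (rule groupI)
  have c: "carrier (presented_group R) = range (pres_class R)"
    and o: "\<one>\<^bsub>presented_group R\<^esub> = pres_class R []"
    by (simp_all add: presented_group_def)
  fix U assume "U \<in> carrier (presented_group R)"
  then obtain u where u: "U = pres_class R u" by (auto simp: c)
  have "pres_class R (word_inv u) \<otimes>\<^bsub>presented_group R\<^esub> U = \<one>\<^bsub>presented_group R\<^esub>"
    by (simp add: u o pres_class_eq_iff pres_eq_word_inv)
  moreover have "pres_class R (word_inv u) \<in> carrier (presented_group R)"
    by (simp add: c)
  ultimately show "\<exists>V\<in>carrier (presented_group R). V \<otimes>\<^bsub>presented_group R\<^esub> U = \<one>\<^bsub>presented_group R\<^esub>"
    by blast
next
  have c: "carrier (presented_group R) = range (pres_class R)"
    and o: "\<one>\<^bsub>presented_group R\<^esub> = pres_class R []"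
    by (simp_all add: presented_group_def)
  show "\<one>\<^bsub>presented_group R\<^esub> \<in> carrier (presented_group R)"
    by (simp add: c o)
  show "\<And>U V. U \<in> carrier (presented_group R) \<Longrightarrow> V \<in> carrier (presented_group R)
      \<Longrightarrow> U \<otimes>\<^bsub>presented_group R\<^esub> V \<in> carrier (presented_group R)"
    by (auto simp: c)
  show "\<And>U V W. U \<in> carrier (presented_group R) \<Longrightarrow> V \<in> carrier (presented_group R)
      \<Longrightarrow> W \<in> carrier (presented_group R)
      \<Longrightarrow> U \<otimes>\<^bsub>presented_group R\<^esub> V \<otimes>\<^bsub>presented_group R\<^esub> W
        = U \<otimes>\<^bsub>presented_group R\<^esub> (V \<otimes>\<^bsub>presented_group R\<^esub> W)"
    by (auto simp: c)
  show "\<And>U. U \<in> carrier (presented_group R)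
      \<Longrightarrow> \<one>\<^bsub>presented_group R\<^esub> \<otimes>\<^bsub>presented_group R\<^esub> U = U"
    by (auto simp: c o)
qed


section \<open>The family \<open>\<Phi>\<^sub>6\<close>\<close>

datatype phi6_gen = Alpha1 | Alpha2 | Beta | Beta1 | Beta2

text \<open>A triple \<open>(x, y, z)\<close> is the relation \<open>[x, y] = z\<close>. Generators whose commutator is not
  prescribed by one of these triples are required to commute.\<close>

definition phi6_comms :: "(phi6_gen \<times> phi6_gen \<times> phi6_gen) set" where
  "phi6_comms = {(Alpha1, Alpha2, Beta), (Beta, Alpha1, Beta1), (Beta, Alpha2, Beta2)}"

definition phi6_rels :: "nat \<Rightarrow> (phi6_gen word \<times> phi6_gen word) set" where
  "phi6_rels p =
     {(word_comm (gen x) (gen y), gen z) | x y z. (x, y, z) \<in> phi6_comms} \<union>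
     {(word_comm (gen x) (gen y), []) | x y.
        \<nexists>z. (x, y, z) \<in> phi6_comms \<or> (y, x, z) \<in> phi6_comms} \<union>
     {(word_pow (gen x) p, []) | x. True}"

definition phi6_1_5 :: "nat \<Rightarrow> phi6_gen word set monoid" where
  "phi6_1_5 p = presented_group (phi6_rels p)"

definition in_Phi6 :: "nat \<Rightarrow> ('a, 'b) monoid_scheme \<Rightarrow> bool" where
  "in_Phi6 p G \<longleftrightarrow> group G \<and> (\<exists>m. order G = p ^ m) \<and> isoclinic G (phi6_1_5 p)"

end

theory Submission
  imports Defs "HOL-Number_Theory.Cong"
begin

text \<open>By Burnside's lemma, \<open>|G| \<alpha>\<^sub>n\<close> is the sum of \<open>|C\<^sub>G(g)|\<^sup>n\<close> over \<open>g \<in> G\<close>, and \<open>|G| \<beta>\<^sub>n\<close> is the number of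
  commuting \<open>(n + 1)\<close>-tuples. Both are determined by the commuting relation on \<open>G/Z(G)\<close>, which is an
  isoclinism invariant. In \<open>\<Phi>\<^sub>6(1\<^sup>5)\<close> the collection process solves the word problem and identifies
  the central quotient, as a set, with the space of triples over the field with \<open>p\<close> elements, in such a
  way that elements commute exactly when their triples are linearly dependent. Hence
  \<open>|G : Z(G)| = p\<^sup>3\<close>, and each noncentral element has an abelian centralizer of order \<open>p |Z(G)|\<close>.\<close>

section \<open>Counting orbits of tuples\<close>

text \<open>Linear dependence has a Lie-theoretic origin. Modulo its center the presented group has
  class 2 and p is odd, so its elements have logarithms x A1 + y A2 + (z/2) B over the field with p
  elements, where A1, A2, B are the logarithms of \<alpha>1, \<alpha>2, \<beta> and B = [A1, A2];
  the triple is (x, y, z). In class 3 the brackets [A1, A2], [B, A1], [B, A2] are independent, so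
  the bracket of two such vectors is given, up to constants, by their three 2x2 minors and vanishes
  only on dependent vectors. The proof replaces this heuristic by explicit collection, which also
  covers p = 3, where the Baker-Campbell-Hausdorff series in class 3 has denominators divisible by
  p. The obstacle is that a presentation bounds its group only from above. That nothing more
  collapses needs a model: the letters act on integer 5-tuples in such a way that the relations hold
  modulo p. The order of the center, which varies with G, cancels when t is divided by |G|.\<close>

lemma (in group) conj_eq_iff:
  assumes "g \<in> carrier G" "x \<in> carrier G" "y \<in> carrier G"
  shows "g \<otimes> x \<otimes> inv g = y \<longleftrightarrow> g \<otimes> x = y \<otimes> g"
  using assms by (metis inv_closed inv_solve_right m_closed)

lemma (in group) conj_fixes_iff:
  assumes g: "g \<in> carrier G" and "set xs \<subseteq> carrier G"
  shows "conj_act G g xs = xs \<longleftrightarrow> (\<forall>x\<in>set xs. g \<otimes> x = x \<otimes> g)"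
proof -
  have "conj_act G g xs = xs \<longleftrightarrow> (\<forall>x\<in>set xs. g \<otimes> x \<otimes> inv g = x)"
    unfolding conj_act_def by (induction xs) auto
  also have "\<dots> \<longleftrightarrow> (\<forall>x\<in>set xs. g \<otimes> x = x \<otimes> g)"
    using assms by (intro ball_cong) (auto simp: conj_eq_iff subset_iff)
  finally show ?thesis .
qed

lemma (in group) conj_act_mult:
  assumes "g \<in> carrier G" "h \<in> carrier G" "set xs \<subseteq> carrier G"
  shows "conj_act G (g \<otimes> h) xs = conj_act G g (conj_act G h xs)"
  using assms by (auto simp: conj_act_def inv_mult_group m_assoc subset_iff)

lemma (in group) conj_act_one:
  assumes "set xs \<subseteq> carrier G"
  shows "conj_act G \<one> xs = xs"
  using assms by (simp add: conj_fixes_iff subset_iff)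

text \<open>Elements of \<open>Bij E\<close> are extensional functions, which forces the restriction
  to E.\<close>

lemma (in group) conj_group_action:
  assumes car: "\<And>xs. xs \<in> E \<Longrightarrow> set xs \<subseteq> carrier G"
    and clo: "\<And>g xs. g \<in> carrier G \<Longrightarrow> xs \<in> E \<Longrightarrow> conj_act G g xs \<in> E"
  shows "group_action G E (\<lambda>g. restrict (conj_act G g) E)"
proof -
  have bij: "restrict (conj_act G g) E \<in> Bij E" if g: "g \<in> carrier G" for g
  proof -
    have "bij_betw (conj_act G g) E E"
      by (rule bij_betw_byWitness[where f' = "conj_act G (inv g)"])
        (use g car clo in \<open>auto simp: conj_act_mult[symmetric] conj_act_one\<close>)
    then show ?thesis
      by (simp add: Bij_def)
  qed
  have "restrict (conj_act G (g \<otimes> h)) E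
      = restrict (conj_act G g) E \<otimes>\<^bsub>BijGroup E\<^esub> restrict (conj_act G h) E"
    if "g \<in> carrier G" "h \<in> carrier G" for g h
    using that bij car clo
    by (auto simp: BijGroup_def compose_def conj_act_mult restrict_def fun_eq_iff)
  with bij have "(\<lambda>g. restrict (conj_act G g) E) \<in> hom G (BijGroup E)"
    by (intro homI) (auto simp: BijGroup_def)
  then show ?thesis
    by (simp add: group_action_def group_hom_def group_hom_axioms_def group_BijGroup)
qed

text \<open>E is an arbitrary conjugation-invariant set of lists, so that one application of
  Burnside's lemma serves both orbit numbers.\<close>

lemma (in group) conj_orbits_count:
  assumes car: "\<And>xs. xs \<in> E \<Longrightarrow> set xs \<subseteq> carrier G"
    and clo: "\<And>g xs. g \<in> carrier G \<Longrightarrow> xs \<in> E \<Longrightarrow> conj_act G g xs \<in> E"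
    and fin: "finite (carrier G)" "finite E"
  shows "card (orbits G E (conj_act G)) * order G
    = (\<Sum>g\<in>carrier G. card {xs \<in> E. \<forall>x\<in>set xs. g \<otimes> x = x \<otimes> g})"
proof -
  let ?\<phi> = "\<lambda>g. restrict (conj_act G g) E"
  interpret group_action G E ?\<phi>
    using car clo by (rule conj_group_action)
  have "orbits G E (conj_act G) = orbits G E ?\<phi>"
    unfolding orbits_def orbit_def by (intro Collect_cong ex_cong) auto
  moreover have "invariants E ?\<phi> g = {xs \<in> E. \<forall>x\<in>set xs. g \<otimes> x = x \<otimes> g}"
    if "g \<in> carrier G" for g
    using that car by (auto simp: invariants_def conj_fixes_iff)
  ultimately show ?thesis
    using burnside[OF fin] by simp
qed

lemma finite_tuples: "finite (carrier G) \<Longrightarrow> finite (tuples G n)"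
  using finite_lists_length_eq[of "carrier G" n] by (simp add: tuples_def conj_commute)

definition centralizer :: "('a, 'b) monoid_scheme \<Rightarrow> 'a \<Rightarrow> 'a set" where
  "centralizer G g = {x \<in> carrier G. g \<otimes>\<^bsub>G\<^esub> x = x \<otimes>\<^bsub>G\<^esub> g}"

lemma (in group) alpha_count:
  assumes fin: "finite (carrier G)"
  shows "alpha G n * order G = (\<Sum>g\<in>carrier G. card (centralizer G g) ^ n)"
proof -
  have "conj_act G g xs \<in> tuples G n" if "g \<in> carrier G" "xs \<in> tuples G n" for g xs
    using that by (auto simp: tuples_def conj_act_def)
  then have "alpha G n * order G
      = (\<Sum>g\<in>carrier G. card {xs \<in> tuples G n. \<forall>x\<in>set xs. g \<otimes> x = x \<otimes> g})"
    unfolding alpha_def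
    by (intro conj_orbits_count fin finite_tuples) (auto simp: tuples_def)
  also have "\<dots> = (\<Sum>g\<in>carrier G. card {xs. set xs \<subseteq> centralizer G g \<and> length xs = n})"
    by (intro sum.cong HOL.refl arg_cong[where f = card]) (auto simp: tuples_def centralizer_def)
  also have "\<dots> = (\<Sum>g\<in>carrier G. card (centralizer G g) ^ n)"
    using fin by (intro sum.cong HOL.refl card_lists_length_eq) (simp add: centralizer_def)
  finally show ?thesis .
qed

lemma Cons_commuting_tuples_iff:
  "g # xs \<in> commuting_tuples G (Suc n) \<longleftrightarrow>
    g \<in> carrier G \<and> xs \<in> commuting_tuples G n \<and> (\<forall>x\<in>set xs. g \<otimes>\<^bsub>G\<^esub> x = x \<otimes>\<^bsub>G\<^esub> g)"
  unfolding commuting_tuples_def tuples_def by (simp add: ball_Un) (smt (verit))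

lemma commuting_tuples_Suc:
  "commuting_tuples G (Suc n) = (\<lambda>(g, xs). g # xs) `
    (SIGMA g:carrier G. {xs \<in> commuting_tuples G n. \<forall>x\<in>set xs. g \<otimes>\<^bsub>G\<^esub> x = x \<otimes>\<^bsub>G\<^esub> g})"
  (is "?L = ?R")
proof (intro equalityI subsetI)
  fix ys assume ys: "ys \<in> ?L"
  then obtain g xs where "ys = g # xs"
    by (cases ys) (auto simp: commuting_tuples_def tuples_def)
  with ys show "ys \<in> ?R"
    by (auto simp: Cons_commuting_tuples_iff)
next
  fix ys assume "ys \<in> ?R"
  then show "ys \<in> ?L"
    by (auto simp: Cons_commuting_tuples_iff)
qed

lemma finite_commuting_tuples: "finite (carrier G) \<Longrightarrow> finite (commuting_tuples G n)"
  using finite_tuples[of G n] by (simp add: commuting_tuples_def)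

lemma card_commuting_tuples_Suc:
  assumes "finite (carrier G)"
  shows "card (commuting_tuples G (Suc n)) = (\<Sum>g\<in>carrier G.
    card {xs \<in> commuting_tuples G n. \<forall>x\<in>set xs. g \<otimes>\<^bsub>G\<^esub> x = x \<otimes>\<^bsub>G\<^esub> g})"
proof -
  have "inj_on (\<lambda>(g, xs). g # xs) A" for A :: "('a \<times> 'a list) set"
    by (auto simp: inj_on_def)
  then show ?thesis
    using assms by (simp add: commuting_tuples_Suc card_image card_SigmaI finite_commuting_tuples)
qed

text \<open>Putting g in front of a commuting n-tuple fixed by g gives a commuting (n + 1)-tuple.
  The Burnside sum is thus the count of (n + 1)-tuples sorted by first entry.\<close>

lemma (in group) beta_count:
  assumes fin: "finite (carrier G)"
  shows "beta G n * order G = card (commuting_tuples G (Suc n))"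
proof -
  have conj_comm: "(g \<otimes> x \<otimes> inv g) \<otimes> (g \<otimes> y \<otimes> inv g) = (g \<otimes> y \<otimes> inv g) \<otimes> (g \<otimes> x \<otimes> inv g)"
    if "g \<in> carrier G" "x \<in> carrier G" "y \<in> carrier G" "x \<otimes> y = y \<otimes> x" for g x y
  proof -
    have "(g \<otimes> u \<otimes> inv g) \<otimes> (g \<otimes> v \<otimes> inv g) = g \<otimes> (u \<otimes> v) \<otimes> inv g"
      if "u \<in> carrier G" "v \<in> carrier G" for u v
      using that \<open>g \<in> carrier G\<close> by (metis inv_closed inv_solve_left m_assoc m_closed)
    with that show ?thesis by simp
  qed
  have "conj_act G g xs \<in> commuting_tuples G n"
    if "g \<in> carrier G" "xs \<in> commuting_tuples G n" for g xs
    using that by (auto simp: commuting_tuples_def tuples_def conj_act_def subset_iff conj_comm)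
  then show ?thesis
    unfolding beta_def card_commuting_tuples_Suc[OF fin]
    by (intro conj_orbits_count fin finite_commuting_tuples)
      (auto simp: commuting_tuples_def tuples_def)
qed

section \<open>Counting when all noncentral centralizers have the same order\<close>

lemma (in group) center_subset: "center G \<subseteq> carrier G"
  by (auto simp: center_def)

lemma (in group) centralizer_central: "g \<in> center G \<Longrightarrow> centralizer G g = carrier G"
  by (auto simp: center_def centralizer_def)

lemma (in group) sum_carrier_center:
  fixes a b :: nat
  assumes "finite (carrier G)"
  shows "(\<Sum>g\<in>carrier G. if g \<in> center G then a else b)
    = card (center G) * a + (order G - card (center G)) * b"
proof -
  have "carrier G \<inter> center G = center G" "carrier G \<inter> - center G = carrier G - center G"
    using center_subset by auto
  then show ?thesis
    using assms center_subset
    by (simp add: sum.If_cases card_Diff_subset finite_subset order_def)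
qed

lemma (in group) alpha_eq:
  assumes fin: "finite (carrier G)"
    and cent: "\<And>g. g \<in> carrier G - center G \<Longrightarrow> card (centralizer G g) = c"
  shows "alpha G n * order G
    = card (center G) * order G ^ n + (order G - card (center G)) * c ^ n"
proof -
  have "card (centralizer G g) ^ n = (if g \<in> center G then order G ^ n else c ^ n)"
    if "g \<in> carrier G" for g
    using that cent by (simp add: centralizer_central order_def)
  then show ?thesis
    by (simp add: alpha_count[OF fin] sum_carrier_center[OF fin])
qed

text \<open>A central first entry leaves the tail free. A noncentral one confines the tail to its
  centralizer, where every tuple commutes because the centralizer is abelian.\<close>

lemma (in group) card_commuting_tuples_rec:
  assumes fin: "finite (carrier G)"
    and cent: "\<And>g. g \<in> carrier G - center G \<Longrightarrow> card (centralizer G g) = c"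
    and abel: "\<And>g x y. g \<in> carrier G - center G \<Longrightarrow> x \<in> centralizer G g \<Longrightarrow>
      y \<in> centralizer G g \<Longrightarrow> x \<otimes> y = y \<otimes> x"
  shows "card (commuting_tuples G (Suc n))
    = card (center G) * card (commuting_tuples G n) + (order G - card (center G)) * c ^ n"
proof -
  have "card {xs \<in> commuting_tuples G n. \<forall>x\<in>set xs. g \<otimes> x = x \<otimes> g}
      = (if g \<in> center G then card (commuting_tuples G n) else c ^ n)"
    if g: "g \<in> carrier G" for g
  proof (cases "g \<in> center G")
    case True
    then have "{xs \<in> commuting_tuples G n. \<forall>x\<in>set xs. g \<otimes> x = x \<otimes> g} = commuting_tuples G n"
      by (auto simp: commuting_tuples_def tuples_def center_def)
    with True show ?thesis by simp
  next
    case False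
    with g have g': "g \<in> carrier G - center G" by simp
    have "{xs \<in> commuting_tuples G n. \<forall>x\<in>set xs. g \<otimes> x = x \<otimes> g}
        = {xs. set xs \<subseteq> centralizer G g \<and> length xs = n}"
      using abel[OF g']
      by (auto simp: commuting_tuples_def tuples_def centralizer_def subset_iff)
    moreover have "finite (centralizer G g)"
      using fin by (simp add: centralizer_def)
    ultimately show ?thesis
      using False cent[OF g'] by (simp add: card_lists_length_eq)
  qed
  then show ?thesis
    by (simp add: card_commuting_tuples_Suc[OF fin] sum_carrier_center[OF fin])
qed

lemma commuting_tuples_0: "commuting_tuples G 0 = {[]}"
  by (auto simp: commuting_tuples_def tuples_def)

text \<open>The factor \<open>p\<^sup>2 + p + 1\<close> is the number of centralizers of noncentral elements: they pairwise
  intersect in the center.\<close>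

lemma (in group) card_commuting_tuples:
  fixes p :: nat
  assumes fin: "finite (carrier G)" and p: "p > 0"
    and ord: "order G = p ^ 3 * card (center G)"
    and cent: "\<And>g. g \<in> carrier G - center G \<Longrightarrow> card (centralizer G g) = p * card (center G)"
    and abel: "\<And>g x y. g \<in> carrier G - center G \<Longrightarrow> x \<in> centralizer G g \<Longrightarrow>
      y \<in> centralizer G g \<Longrightarrow> x \<otimes> y = y \<otimes> x"
  shows "(of_nat (card (commuting_tuples G n)) :: rat)
    = of_nat (card (center G)) ^ n * (1 + (of_nat p ^ 2 + of_nat p + 1) * (of_nat p ^ n - 1))"
proof (induction n)
  case 0
  show ?case by (simp add: commuting_tuples_0)
next
  case (Suc n)
  let ?z = "of_nat (card (center G)) :: rat" and ?q = "of_nat p :: rat"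
  have "card (center G) \<le> order G"
    using center_subset fin by (simp add: order_def card_mono)
  then have "of_nat (order G - card (center G)) = (?q ^ 3 - 1) * ?z"
    by (simp add: of_nat_diff ord algebra_simps)
  then have "of_nat (card (commuting_tuples G (Suc n)))
      = ?z * of_nat (card (commuting_tuples G n)) + (?q ^ 3 - 1) * ?z * (?q * ?z) ^ n"
    using card_commuting_tuples_rec[where n = n, OF fin cent abel] by simp
  \<comment> \<open>With s = q^2 + q + 1 we have q^3 - 1 = s (q - 1), and the sum telescopes: s (q^n
    - 1) + s (q - 1) q^n = s (q^(n+1) - 1).\<close>
  also have "\<dots> = ?z ^ Suc n * (1 + (?q ^ 2 + ?q + 1) * (?q ^ Suc n - 1))"
    unfolding Suc.IH
    by (simp add: power_mult_distrib power2_eq_square power3_eq_cube algebra_simps)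
  finally show ?case .
qed

section \<open>Generating functions as sums of two geometric series\<close>

lemma fps_geometric_nth:
  fixes a b :: "'a :: field"
  shows "fps_nth (fps_const a / (1 - fps_const b * fps_X)) n = a * b ^ n"
proof -
  have "(1 - fps_const b * fps_X) * Abs_fps (\<lambda>n. b ^ n) = (1 :: 'a fps)"
  proof (rule fps_ext)
    fix n
    show "fps_nth ((1 - fps_const b * fps_X) * Abs_fps (\<lambda>n. b ^ n)) n = fps_nth (1 :: 'a fps) n"
      by (cases n) (simp_all add: left_diff_distrib mult.assoc)
  qed
  then have "inverse (1 - fps_const b * fps_X) = Abs_fps (\<lambda>n. b ^ n)"
    by (rule fps_inverse_unique)
  then show ?thesis
    by (simp add: fps_divide_unit)
qed

lemma fps_geometric_nth_1:
  fixes a :: "'a :: field"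
  shows "fps_nth (fps_const a / (1 - fps_X)) n = a"
  using fps_geometric_nth[of a 1 n] by simp

lemma (in group) series_of_abelian_centralizers:
  fixes p :: nat
  assumes fin: "finite (carrier G)" and p: "p > 0"
    and ord: "order G = p ^ 3 * card (center G)"
    and cent: "\<And>g. g \<in> carrier G - center G \<Longrightarrow> card (centralizer G g) = p * card (center G)"
    and abel: "\<And>g x y. g \<in> carrier G - center G \<Longrightarrow> x \<in> centralizer G g \<Longrightarrow>
      y \<in> centralizer G g \<Longrightarrow> x \<otimes> y = y \<otimes> x"
  shows "A_series G oo (fps_const (1 / of_nat (order G)) * fps_X) =
      fps_const (1 - of_nat p powi (-3)) / (1 - fps_const (of_nat p powi (-2)) * fps_X)
      + fps_const (of_nat p powi (-3)) / (1 - fps_X)" (is ?A)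
    and "B_series G oo (fps_const (1 / of_nat (order G)) * fps_X) =
      fps_const (- (of_nat p powi (-1)) - of_nat p powi (-2))
        / (1 - fps_const (of_nat p powi (-3)) * fps_X)
      + fps_const (1 + of_nat p powi (-1) + of_nat p powi (-2))
        / (1 - fps_const (of_nat p powi (-2)) * fps_X)" (is ?B)
proof -
  let ?z = "of_nat (card (center G)) :: rat" and ?q = "of_nat p :: rat"
  let ?N = "of_nat (order G) :: rat"
  have q: "?q \<noteq> 0" using p by simp
  have N: "?N = ?q ^ 3 * ?z" by (simp add: ord)
  have N0: "?N \<noteq> 0"
    using fin by (simp add: order_gt_0_iff_finite[symmetric])
  then have z: "?z \<noteq> 0" by (auto simp: N)
  have powi: "?q powi (-1) = 1 / ?q" "?q powi (-2) = 1 / ?q ^ 2" "?q powi (-3) = 1 / ?q ^ 3"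
    by (simp_all add: power_int_minus divide_inverse)
  have zle: "card (center G) \<le> order G"
    using center_subset fin by (simp add: order_def card_mono)
  show ?A
  proof (rule fps_ext)
    fix n
    have "of_nat (alpha G n) * ?N = of_nat (alpha G n * order G)" by simp
    also have "\<dots> = ?z * ?N ^ n + (?N - ?z) * (?q * ?z) ^ n"
      using alpha_eq[where n = n, OF fin cent] zle by (simp add: of_nat_diff)
    finally have "of_nat (alpha G n) = (?z * ?N ^ n + (?N - ?z) * (?q * ?z) ^ n) / ?N"
      using N0 by (simp add: eq_divide_eq)
    then have "(1 / ?N) ^ n * of_nat (alpha G n)
        = ?z / ?N + (?N - ?z) / ?N * (?q * ?z / ?N) ^ n"
      using N0 by (simp add: field_simps)
    \<comment> \<open>The proportion of central elements is the numerator over 1 - t. The proportion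
      of the group filled by a noncentral centralizer is the ratio p^-2 of the other geometric
      series.\<close>
    also have "?z / ?N = 1 / ?q ^ 3" using z by (simp add: N)
    also have "(?N - ?z) / ?N = 1 - 1 / ?q ^ 3" using z q by (simp add: N field_simps)
    also have "?q * ?z / ?N = 1 / ?q ^ 2"
      using z q by (simp add: N power3_eq_cube power2_eq_square)
    finally show "fps_nth (A_series G oo (fps_const (1 / ?N) * fps_X)) n = fps_nth (
        fps_const (1 - ?q powi (-3)) / (1 - fps_const (?q powi (-2)) * fps_X)
        + fps_const (?q powi (-3)) / (1 - fps_X)) n"
      unfolding fps_nth_compose_linear fps_add_nth fps_geometric_nth fps_geometric_nth_1 powi
      by (simp add: A_series_def)
  qed
  show ?B
  proof (rule fps_ext)
    fix n
    \<comment> \<open>Used with r = p^-3 and s = p^2 + p + 1: the part without q^n gives the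
      geometric sequence of ratio p^-3, the part with q^n the one of ratio p^-2.\<close>
    have split: "r ^ n * r * (1 + s * (?q ^ Suc n - 1)) = (r * (1 - s)) * r ^ n + (r * s * ?q) * (r * ?q) ^ n"
      for r s :: rat
      by (simp add: power_mult_distrib algebra_simps)
    have "of_nat (beta G n) * ?N = of_nat (beta G n * order G)" by simp
    also have "\<dots> = ?z ^ Suc n * (1 + (?q ^ 2 + ?q + 1) * (?q ^ Suc n - 1))"
      unfolding beta_count[OF fin] by (rule card_commuting_tuples[OF assms])
    finally have "(1 / ?N) ^ n * of_nat (beta G n)
        = (?z / ?N) ^ n * (?z / ?N) * (1 + (?q ^ 2 + ?q + 1) * (?q ^ Suc n - 1))"
      using N0 by (simp add: field_simps)
    also have "?z / ?N = 1 / ?q ^ 3" using z by (simp add: N)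
    also have "(1 / ?q ^ 3) ^ n * (1 / ?q ^ 3) * (1 + (?q ^ 2 + ?q + 1) * (?q ^ Suc n - 1))
        = (1 / ?q ^ 3 * (1 - (?q ^ 2 + ?q + 1))) * (1 / ?q ^ 3) ^ n
          + (1 / ?q ^ 3 * (?q ^ 2 + ?q + 1) * ?q) * (1 / ?q ^ 3 * ?q) ^ n"
      by (rule split)
    also have "1 / ?q ^ 3 * (1 - (?q ^ 2 + ?q + 1)) = - (1 / ?q) - 1 / ?q ^ 2"
      using q by (simp add: power3_eq_cube power2_eq_square field_simps)
    also have "1 / ?q ^ 3 * (?q ^ 2 + ?q + 1) * ?q = 1 + 1 / ?q + 1 / ?q ^ 2"
      using q by (simp add: power3_eq_cube power2_eq_square field_simps)
    also have "1 / ?q ^ 3 * ?q = 1 / ?q ^ 2"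
      using q by (simp add: power3_eq_cube power2_eq_square)
    finally show "fps_nth (B_series G oo (fps_const (1 / ?N) * fps_X)) n = fps_nth (
        fps_const (- (?q powi (-1)) - ?q powi (-2)) / (1 - fps_const (?q powi (-3)) * fps_X)
        + fps_const (1 + ?q powi (-1) + ?q powi (-2)) / (1 - fps_const (?q powi (-2)) * fps_X)) n"
      unfolding fps_nth_compose_linear fps_add_nth fps_geometric_nth powi
      by (simp add: B_series_def)
  qed
qed

section \<open>Coordinates for words in the generators\<close>

type_synonym coords = "int \<times> int \<times> int \<times> int \<times> int"

text \<open>The coordinates \<open>(j, i, k, l, m)\<close> stand for \<open>\<alpha>\<^sub>2\<^sup>j \<alpha>\<^sub>1\<^sup>i \<beta>\<^sup>k \<gamma>\<^sub>1\<^sup>l \<gamma>\<^sub>2\<^sup>m\<close>, where \<open>\<gamma>\<^sub>1\<close>, \<open>\<gamma>\<^sub>2\<close> are the square roots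
  of \<open>\<beta>\<^sub>1\<close>, \<open>\<beta>\<^sub>2\<close>; this keeps the collection formulas free of division by 2.\<close>

fun coords_mult :: "coords \<Rightarrow> coords \<Rightarrow> coords" where
  "coords_mult (j, i, k, l, m) (j', i', k', l', m') =
    (j + j', i + i', k + k' + i * j',
     l + l' + 2 * k * i' + 2 * i * i' * j' + j' * i * (i - 1),
     m + m' + 2 * k * j' + i * j' * (j' - 1))"

text \<open>Left multiplication by one letter, brought back to collected form. Words act through
  their letters, so concatenation becomes composition and no general associativity law for
  \<open>coords_mult\<close> has to be established first.\<close>

fun letter_act :: "bool \<times> phi6_gen \<Rightarrow> coords \<Rightarrow> coords" where
  "letter_act (True, Alpha1) (j, i, k, l, m) = (j, i + 1, k + j, l + 2 * i * j, m + j * (j - 1))"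
| "letter_act (True, Alpha2) (j, i, k, l, m) = (j + 1, i, k, l, m)"
| "letter_act (True, Beta) (j, i, k, l, m) = (j, i, k + 1, l + 2 * i, m + 2 * j)"
| "letter_act (True, Beta1) (j, i, k, l, m) = (j, i, k, l + 2, m)"
| "letter_act (True, Beta2) (j, i, k, l, m) = (j, i, k, l, m + 2)"
| "letter_act (False, Alpha1) (j, i, k, l, m) =
    (j, i - 1, k - j, l - 2 * (i - 1) * j, m - j * (j - 1))"
| "letter_act (False, Alpha2) (j, i, k, l, m) = (j - 1, i, k, l, m)"
| "letter_act (False, Beta) (j, i, k, l, m) = (j, i, k - 1, l - 2 * i, m - 2 * j)"
| "letter_act (False, Beta1) (j, i, k, l, m) = (j, i, k, l - 2, m)"
| "letter_act (False, Beta2) (j, i, k, l, m) = (j, i, k, l, m - 2)"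

abbreviation word_act :: "phi6_gen word \<Rightarrow> coords \<Rightarrow> coords" where
  "word_act w \<equiv> foldr letter_act w"

abbreviation word_coords :: "phi6_gen word \<Rightarrow> coords" where
  "word_coords w \<equiv> word_act w (0, 0, 0, 0, 0)"

text \<open>Left and right multiplication commute. This is the only instance of associativity that
  is computed; it makes \<open>word_coords\<close> multiplicative.\<close>

lemma letter_act_mult: "letter_act a (coords_mult s t) = coords_mult (letter_act a s) t"
proof -
  obtain e x where a: "a = (e, x)" by (cases a)
  obtain j i k l m where s: "s = (j, i, k, l, m)" by (cases s)
  obtain j' i' k' l' m' where t: "t = (j', i', k', l', m')" by (cases t)
  show ?thesis
    unfolding a s t by (cases e; cases x) (simp_all add: algebra_simps)
qed

lemma word_act_mult: "word_act w (coords_mult s t) = coords_mult (word_act w s) t"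
  by (induction w) (simp_all add: letter_act_mult)

lemma word_act_eq: "word_act w t = coords_mult (word_coords w) t"
  using word_act_mult[of w "(0, 0, 0, 0, 0)" t] by (cases t) simp

lemma word_coords_append: "word_coords (u @ v) = coords_mult (word_coords u) (word_coords v)"
  by (simp add: word_act_eq[symmetric])

lemma letter_act_cancel: "letter_act (e, x) (letter_act (\<not> e, x) t) = t"
proof -
  obtain j i k l m where t: "t = (j, i, k, l, m)" by (cases t)
  show ?thesis
    unfolding t by (cases e; cases x) (simp_all add: algebra_simps)
qed

fun coords_cong :: "nat \<Rightarrow> coords \<Rightarrow> coords \<Rightarrow> bool" where
  "coords_cong p (j, i, k, l, m) (j', i', k', l', m') \<longleftrightarrow>
    [j = j'] (mod int p) \<and> [i = i'] (mod int p) \<and> [k = k'] (mod int p) \<and>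
    [l = l'] (mod int p) \<and> [m = m'] (mod int p)"

lemma coords_cong_refl: "coords_cong p s s"
  by (cases s) simp

lemma coords_cong_sym: "coords_cong p s t \<Longrightarrow> coords_cong p t s"
  by (cases s; cases t) (simp add: cong_sym)

lemma coords_cong_trans: "coords_cong p s t \<Longrightarrow> coords_cong p t u \<Longrightarrow> coords_cong p s u"
  by (cases s; cases t; cases u) (auto intro: cong_trans)

lemma coords_cong_mult:
  assumes "coords_cong p s s'" "coords_cong p t t'"
  shows "coords_cong p (coords_mult s t) (coords_mult s' t')"
proof -
  obtain j i k l m where s: "s = (j, i, k, l, m)" by (cases s)
  obtain j' i' k' l' m' where t: "t = (j', i', k', l', m')" by (cases t)
  obtain a b c d e where s': "s' = (a, b, c, d, e)" by (cases s')
  obtain a' b' c' d' e' where t': "t' = (a', b', c', d', e')" by (cases t')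
  show ?thesis
    using assms unfolding s t s' t'
    by (auto intro!: cong_add cong_mult cong_diff)
qed

text \<open>For \<open>Alpha1\<close> each application raises i by one, so the increments 2 i j of
  the fourth entry add up to 2 n i j + n (n - 1) j. All increments are multiples of n, hence vanish
  modulo p when n = p.\<close>

lemma word_act_pow_gen:
  "word_act (word_pow (gen x) n) (j, i, k, l, m) =
    (case x of
      Alpha1 \<Rightarrow> (j, i + int n, k + int n * j,
        l + int n * (2 * i * j + (int n - 1) * j), m + int n * (j * (j - 1)))
    | Alpha2 \<Rightarrow> (j + int n, i, k, l, m)
    | Beta \<Rightarrow> (j, i, k + int n, l + int n * (2 * i), m + int n * (2 * j))
    | Beta1 \<Rightarrow> (j, i, k, l + int n * 2, m)
    | Beta2 \<Rightarrow> (j, i, k, l, m + int n * 2))"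
proof (induction n)
  case 0
  show ?case by (cases x) (simp_all add: word_pow_def)
next
  case (Suc n)
  have step: "word_act (word_pow (gen x) (Suc n)) t
      = letter_act (True, x) (word_act (word_pow (gen x) n) t)" for t
    by (simp add: word_pow_def gen_def)
  show ?case
    unfolding step Suc.IH by (cases x) (simp_all add: algebra_simps)
qed

text \<open>The commutator relations hold exactly over the integers; only the power relations need
  the modulus.\<close>

lemma word_coords_rel:
  assumes "(u, v) \<in> phi6_rels p"
  shows "coords_cong p (word_coords u) (word_coords v)"
proof -
  consider (comm) x y z where "u = word_comm (gen x) (gen y)" "v = gen z" "(x, y, z) \<in> phi6_comms"
    | (commute) x y where "u = word_comm (gen x) (gen y)" "v = []"
        "\<nexists>z. (x, y, z) \<in> phi6_comms \<or> (y, x, z) \<in> phi6_comms"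
    | (pow) x where "u = word_pow (gen x) p" "v = []"
    using assms unfolding phi6_rels_def by blast
  then show ?thesis
  proof cases
    case comm
    then have "word_coords u = word_coords v"
      by (auto simp: phi6_comms_def word_comm_def word_inv_def gen_def)
    then show ?thesis by (simp add: coords_cong_refl)
  next
    case commute
    then have "word_coords u = word_coords v"
      by (cases x; cases y) (simp_all add: phi6_comms_def word_comm_def word_inv_def gen_def)
    then show ?thesis by (simp add: coords_cong_refl)
  next
    case pow
    then show ?thesis
      by (cases x) (simp_all add: word_act_pow_gen cong_def)
  qed
qed

text \<open>The half of the word problem that rules out collapse: words with incongruent coordinates
  represent different elements.\<close>

lemma word_coords_cong:
  "pres_eq (phi6_rels p) u v \<Longrightarrow> coords_cong p (word_coords u) (word_coords v)"
proof (induction rule: pres_eq.induct)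
  case (refl u)
  show ?case by (rule coords_cong_refl)
next
  case (sym u v)
  then show ?case by (blast intro: coords_cong_sym)
next
  case (trans u v w)
  then show ?case by (blast intro: coords_cong_trans)
next
  case (mult u u' v v')
  then show ?case by (simp add: word_coords_append coords_cong_mult del: foldr_append)
next
  case (cancel e x)
  show ?case using letter_act_cancel[of e x] by (simp add: coords_cong_refl)
next
  case (rel u v)
  then show ?case by (rule word_coords_rel)
qed

section \<open>Collection in a group satisfying the relations\<close>

lemma (in group) commute_nat_pow:
  assumes "x \<in> carrier G" "y \<in> carrier G" "x \<otimes> y = y \<otimes> x"
  shows "x [^] (n :: nat) \<otimes> y = y \<otimes> x [^] n"
proof (induction n)
  case 0
  show ?case using assms by simp
next
  case (Suc n)
  have "x [^] Suc n \<otimes> y = x [^] n \<otimes> y \<otimes> x"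
    using assms by (simp add: m_assoc)
  also have "\<dots> = y \<otimes> x [^] Suc n"
    using assms by (simp add: Suc.IH m_assoc)
  finally show ?case .
qed

lemma (in group) commute_inv:
  assumes "x \<in> carrier G" "y \<in> carrier G" "x \<otimes> y = y \<otimes> x"
  shows "inv x \<otimes> y = y \<otimes> inv x"
  using assms by (metis inv_closed inv_solve_left inv_solve_right m_assoc m_closed)

lemma (in group) commute_int_pow:
  assumes "x \<in> carrier G" "y \<in> carrier G" "x \<otimes> y = y \<otimes> x"
  shows "x [^] (n :: int) \<otimes> y = y \<otimes> x [^] n"
proof -
  have pow: "x [^] m \<otimes> y = y \<otimes> x [^] m" for m :: nat
    by (rule commute_nat_pow[OF assms])
  have "inv (x [^] m) \<otimes> y = y \<otimes> inv (x [^] m)" for m :: nat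
    using assms by (intro commute_inv pow) simp_all
  with pow show ?thesis
    unfolding int_pow_def2 by (cases "n < 0") (simp_all only: if_True if_False)
qed

lemma (in group) left_pow_collect:
  assumes car: "x \<in> carrier G" "y \<in> carrier G" "z \<in> carrier G"
    and yx: "y \<otimes> x = x \<otimes> y \<otimes> z" and zy: "z \<otimes> y = y \<otimes> z"
  shows "y [^] (k :: nat) \<otimes> x = x \<otimes> y [^] k \<otimes> z [^] k"
proof (induction k)
  case 0
  show ?case using car by simp
next
  case (Suc k)
  have "y [^] Suc k \<otimes> x = (y [^] k \<otimes> x) \<otimes> y \<otimes> z"
    using car by (simp add: m_assoc yx)
  also have "\<dots> = x \<otimes> y [^] k \<otimes> (z [^] k \<otimes> y) \<otimes> z"
    using car by (simp add: Suc.IH m_assoc)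
  also have "\<dots> = x \<otimes> y [^] Suc k \<otimes> z [^] Suc k"
    unfolding commute_nat_pow[OF car(3,2) zy] using car by (simp add: m_assoc)
  finally show ?case .
qed

lemma (in group) right_pow_collect:
  assumes car: "x \<in> carrier G" "y \<in> carrier G" "z \<in> carrier G"
    and yx: "y \<otimes> x = x \<otimes> y \<otimes> z" and zx: "z \<otimes> x = x \<otimes> z"
  shows "y \<otimes> x [^] (i :: nat) = x [^] i \<otimes> y \<otimes> z [^] i"
proof (induction i)
  case 0
  show ?case using car by simp
next
  case (Suc i)
  have "y \<otimes> x [^] Suc i = (y \<otimes> x [^] i) \<otimes> x"
    using car by (simp add: m_assoc)
  also have "\<dots> = x [^] i \<otimes> y \<otimes> (z [^] i \<otimes> x)"
    using car by (simp add: Suc.IH m_assoc)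
  also have "\<dots> = x [^] i \<otimes> (y \<otimes> x) \<otimes> z [^] i"
    unfolding commute_nat_pow[OF car(3,1) zx] using car by (simp add: m_assoc)
  also have "\<dots> = x [^] Suc i \<otimes> y \<otimes> z [^] Suc i"
    unfolding nat_pow_Suc2[OF car(3)] using car by (simp add: yx m_assoc)
  finally show ?case .
qed

text \<open>Moving \<open>y [^] k\<close> past a single x shows that x, \<open>y [^] k\<close>,
  \<open>z [^] k\<close> satisfy the same kind of relation as x, y, z; a second collection then
  moves it past \<open>x [^] i\<close>.\<close>

lemma (in group) pow_collect:
  assumes car: "x \<in> carrier G" "y \<in> carrier G" "z \<in> carrier G"
    and yx: "y \<otimes> x = x \<otimes> y \<otimes> z" and zy: "z \<otimes> y = y \<otimes> z" and zx: "z \<otimes> x = x \<otimes> z"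
  shows "y [^] (k :: nat) \<otimes> x [^] (i :: nat) = x [^] i \<otimes> y [^] k \<otimes> z [^] (k * i)"
proof -
  have "y [^] k \<otimes> x [^] i = x [^] i \<otimes> y [^] k \<otimes> (z [^] k) [^] i"
    using car by (intro right_pow_collect left_pow_collect yx zy commute_nat_pow zx) auto
  then show ?thesis
    using car by (simp add: nat_pow_pow)
qed

lemma (in group) int_pow_cong:
  assumes "x \<in> carrier G" "x [^] p = \<one>" "[m = n] (mod int p)"
  shows "x [^] m = x [^] n"
proof -
  obtain d where "n = m + int p * d"
    using assms(3) by (auto simp: cong_iff_lin)
  moreover have "x [^] (int p * d) = \<one>"
    using assms(1,2) by (simp add: int_pow_pow[symmetric] int_pow_int)
  ultimately show ?thesis
    using assms(1) by (simp add: int_pow_mult)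
qed

text \<open>Rules for merging adjacent powers; the versions with a trailing factor r work inside
  right-nested products.\<close>

lemma (in group) int_pow_join:
  fixes m n :: int
  assumes x: "x \<in> carrier G"
  shows "x [^] m \<otimes> x [^] n = x [^] (m + n)"
    and "x \<otimes> x [^] n = x [^] (1 + n)"
    and "x [^] n \<otimes> x = x [^] (1 + n)"
    and "r \<in> carrier G \<Longrightarrow> x [^] m \<otimes> (x [^] n \<otimes> r) = x [^] (m + n) \<otimes> r"
    and "r \<in> carrier G \<Longrightarrow> x \<otimes> (x [^] n \<otimes> r) = x [^] (1 + n) \<otimes> r"
    and "r \<in> carrier G \<Longrightarrow> x [^] n \<otimes> (x \<otimes> r) = x [^] (1 + n) \<otimes> r"
proof -
  show 1: "x [^] m \<otimes> x [^] n = x [^] (m + n)"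
    using x by (simp add: int_pow_mult)
  show 2: "x \<otimes> x [^] n = x [^] (1 + n)"
    using x by (simp add: int_pow_mult)
  show 3: "x [^] n \<otimes> x = x [^] (1 + n)"
    using int_pow_mult[OF x, of n 1] x by (simp add: add.commute)
  show "r \<in> carrier G \<Longrightarrow> x [^] m \<otimes> (x [^] n \<otimes> r) = x [^] (m + n) \<otimes> r"
    using x by (simp add: 1 m_assoc[symmetric])
  show "r \<in> carrier G \<Longrightarrow> x \<otimes> (x [^] n \<otimes> r) = x [^] (1 + n) \<otimes> r"
    using x by (simp add: 2 m_assoc[symmetric])
  show "r \<in> carrier G \<Longrightarrow> x [^] n \<otimes> (x \<otimes> r) = x [^] (1 + n) \<otimes> r"
    using x by (simp add: 3 m_assoc[symmetric])
qed

text \<open>Collection formulas are proved by induction on natural exponents. Since the generators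
  satisfy \<open>x [^] p = \<one>\<close>, replacing an integer exponent by a congruent natural
  number carries them over to all integers.\<close>

lemma obtain_nat_cong:
  assumes "p > 0"
  obtains k where "[int k = n] (mod int p)"
proof
  show "[int (nat (n mod int p)) = n] (mod int p)"
    using assms by simp
qed

text \<open>The relations in collection form: [x, y] = z is written x y = y x z, and trivial
  commutators involving \<open>b1\<close> or \<open>b2\<close> become commuting rules.\<close>

locale phi6_presentation = group +
  fixes p :: nat and a1 a2 b b1 b2 :: 'a
  assumes odd_p: "odd p"
    and gens_closed [simp]: "a1 \<in> carrier G" "a2 \<in> carrier G" "b \<in> carrier G"
      "b1 \<in> carrier G" "b2 \<in> carrier G"
    and comm_a1_a2: "a1 \<otimes> a2 = a2 \<otimes> a1 \<otimes> b"
    and comm_b_a1: "b \<otimes> a1 = a1 \<otimes> b \<otimes> b1"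
    and comm_b_a2: "b \<otimes> a2 = a2 \<otimes> b \<otimes> b2"
    and b1_central: "\<And>x. x \<in> {a1, a2, b, b2} \<Longrightarrow> b1 \<otimes> x = x \<otimes> b1"
    and b2_central: "\<And>x. x \<in> {a1, a2, b, b1} \<Longrightarrow> b2 \<otimes> x = x \<otimes> b2"
    and pow_p: "\<And>x. x \<in> {a1, a2, b, b1, b2} \<Longrightarrow> x [^] p = \<one>"
begin

text \<open>As p is odd, (p + 1) / 2 inverts 2 modulo p, so \<open>c1\<close> and \<open>c2\<close>
  are square roots of \<open>b1\<close> and \<open>b2\<close>.\<close>

definition "c1 = b1 [^] ((p + 1) div 2)"
definition "c2 = b2 [^] ((p + 1) div 2)"

lemma c_closed [simp]: "c1 \<in> carrier G" "c2 \<in> carrier G"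
  by (simp_all add: c1_def c2_def)

lemma c_pow_p: "c1 [^] p = \<one>" "c2 [^] p = \<one>"
proof -
  have "b1 [^] (p * ((p + 1) div 2)) = \<one>" "b2 [^] (p * ((p + 1) div 2)) = \<one>"
    by (simp_all add: nat_pow_pow[symmetric] pow_p)
  then show "c1 [^] p = \<one>" "c2 [^] p = \<one>"
    by (simp_all add: c1_def c2_def nat_pow_pow mult.commute)
qed

lemma c_pow_2: "c1 [^] (2 * n :: int) = b1 [^] n" "c2 [^] (2 * n :: int) = b2 [^] n"
proof -
  have e: "(p + 1) div 2 * 2 = p + 1"
    using odd_p by presburger
  have "x [^] ((p + 1) div 2 * 2) = x" if "x \<in> {b1, b2}" for x
    unfolding e using that pow_p by auto
  then have "(b1 [^] ((p + 1) div 2)) [^] (2 :: nat) = b1" "(b2 [^] ((p + 1) div 2)) [^] (2 :: nat) = b2"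
    by (simp_all add: nat_pow_pow)
  then have "c1 [^] (2 :: int) = b1" "c2 [^] (2 :: int) = b2"
    using int_pow_int[of G c1 2] int_pow_int[of G c2 2] by (simp_all add: c1_def c2_def)
  then show "c1 [^] (2 * n :: int) = b1 [^] n" "c2 [^] (2 * n :: int) = b2 [^] n"
    by (simp_all add: int_pow_pow[symmetric])
qed

lemma c_central:
  fixes n :: int
  shows "x \<in> {a1, a2, b} \<Longrightarrow> c1 [^] n \<otimes> x = x \<otimes> c1 [^] n"
    and "x \<in> {a1, a2, b, c1} \<Longrightarrow> c2 [^] n \<otimes> x = x \<otimes> c2 [^] n"
proof -
  have c1: "c1 \<otimes> x = x \<otimes> c1" if "x \<in> {a1, a2, b}" for x
    unfolding c1_def using that b1_central by (auto intro!: commute_nat_pow)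
  have c2: "c2 \<otimes> x = x \<otimes> c2" if "x \<in> {a1, a2, b, b1}" for x
    unfolding c2_def using that b2_central by (auto intro!: commute_nat_pow)
  have c21: "c2 \<otimes> c1 = c1 \<otimes> c2"
    unfolding c1_def by (rule commute_nat_pow[symmetric]) (simp_all add: c2)
  show "c1 [^] n \<otimes> x = x \<otimes> c1 [^] n" if "x \<in> {a1, a2, b}"
    by (rule commute_int_pow) (use that c1[OF that] in auto)
  show "c2 [^] n \<otimes> x = x \<otimes> c2 [^] n" if "x \<in> {a1, a2, b, c1}"
    by (rule commute_int_pow) (use that c2[of x] c21 in auto)
qed

lemma c_pow_lcomm:
  fixes n k :: int
  shows "x \<in> {a1, a2, b} \<Longrightarrow> r \<in> carrier G \<Longrightarrow>
      c1 [^] n \<otimes> (x [^] k \<otimes> r) = x [^] k \<otimes> (c1 [^] n \<otimes> r)"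
    and "x \<in> {a1, a2, b, c1} \<Longrightarrow> r \<in> carrier G \<Longrightarrow>
      c2 [^] n \<otimes> (x [^] k \<otimes> r) = x [^] k \<otimes> (c2 [^] n \<otimes> r)"
proof -
  have "c1 [^] n \<otimes> x [^] k = x [^] k \<otimes> c1 [^] n" if "x \<in> {a1, a2, b}"
    using that c_central(1)[OF that, of n] by (subst commute_int_pow) auto
  then show "x \<in> {a1, a2, b} \<Longrightarrow> r \<in> carrier G \<Longrightarrow>
      c1 [^] n \<otimes> (x [^] k \<otimes> r) = x [^] k \<otimes> (c1 [^] n \<otimes> r)"
    by (auto simp: m_assoc[symmetric])
  have "c2 [^] n \<otimes> x [^] k = x [^] k \<otimes> c2 [^] n" if "x \<in> {a1, a2, b, c1}"
    using that c_central(2)[OF that, of n] by (subst commute_int_pow) auto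
  then show "x \<in> {a1, a2, b, c1} \<Longrightarrow> r \<in> carrier G \<Longrightarrow>
      c2 [^] n \<otimes> (x [^] k \<otimes> r) = x [^] k \<otimes> (c2 [^] n \<otimes> r)"
    by (auto simp: m_assoc[symmetric])
qed

lemma p_pos: "p > 0"
  using odd_p by (cases p) auto

lemma gen_pow_cong:
  assumes "x \<in> {a1, a2, b, b1, b2, c1, c2}" "[m = n] (mod int p)"
  shows "x [^] m = x [^] n"
  by (rule int_pow_cong[OF _ _ assms(2)]) (use assms(1) pow_p c_pow_p in auto)

lemma b_pow_a1_pow: "b [^] (k :: int) \<otimes> a1 [^] (i :: int) = a1 [^] i \<otimes> b [^] k \<otimes> c1 [^] (2 * k * i)"
proof -
  obtain k' i' where k: "[k = int k'] (mod int p)" and i: "[i = int i'] (mod int p)"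
    using obtain_nat_cong[OF p_pos] cong_sym by metis
  have "b [^] k' \<otimes> a1 [^] i' = a1 [^] i' \<otimes> b [^] k' \<otimes> b1 [^] (k' * i')"
    by (rule pow_collect) (simp_all add: comm_b_a1 b1_central)
  then have "b [^] int k' \<otimes> a1 [^] int i' = a1 [^] int i' \<otimes> b [^] int k' \<otimes> b1 [^] (int k' * int i')"
    by (simp only: int_pow_int of_nat_mult[symmetric])
  moreover have "b1 [^] (k * i) = b1 [^] (int k' * int i')"
    using k i by (intro gen_pow_cong cong_mult) auto
  ultimately show ?thesis
    using gen_pow_cong[OF _ k, of b] gen_pow_cong[OF _ i, of a1] c_pow_2(1)[of "k * i"]
    by (simp add: mult.assoc)
qed

lemma b_pow_a2_pow: "b [^] (k :: int) \<otimes> a2 [^] (j :: int) = a2 [^] j \<otimes> b [^] k \<otimes> c2 [^] (2 * k * j)"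
proof -
  obtain k' j' where k: "[k = int k'] (mod int p)" and j: "[j = int j'] (mod int p)"
    using obtain_nat_cong[OF p_pos] cong_sym by metis
  have "b [^] k' \<otimes> a2 [^] j' = a2 [^] j' \<otimes> b [^] k' \<otimes> b2 [^] (k' * j')"
    by (rule pow_collect) (simp_all add: comm_b_a2 b2_central)
  then have "b [^] int k' \<otimes> a2 [^] int j' = a2 [^] int j' \<otimes> b [^] int k' \<otimes> b2 [^] (int k' * int j')"
    by (simp only: int_pow_int of_nat_mult[symmetric])
  moreover have "b2 [^] (k * j) = b2 [^] (int k' * int j')"
    using k j by (intro gen_pow_cong cong_mult) auto
  ultimately show ?thesis
    using gen_pow_cong[OF _ k, of b] gen_pow_cong[OF _ j, of a2] c_pow_2(2)[of "k * j"]
    by (simp add: mult.assoc)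
qed

text \<open>Each further \<open>a2\<close> turns one more \<open>a1 \<otimes> a2\<close> into
  \<open>a2 \<otimes> a1 \<otimes> b\<close> and must also pass the b's already produced, which
  costs \<open>b2 [^] n\<close>, that is \<open>c2 [^] (2 * n)\<close>. The exponent is 2 (0 + 1 +
  ... + (j - 1)) = j (j - 1).\<close>

lemma a1_a2_pow: "a1 \<otimes> a2 [^] (j :: int) = a2 [^] j \<otimes> a1 \<otimes> b [^] j \<otimes> c2 [^] (j * (j - 1))"
proof -
  have *: "a1 \<otimes> a2 [^] int n = a2 [^] int n \<otimes> a1 \<otimes> b [^] int n \<otimes> c2 [^] (int n * (int n - 1))" for n
  proof (induction n)
    case 0
    show ?case by simp
  next
    case (Suc n)
    let ?n = "int n"
    have "a1 \<otimes> a2 [^] int (Suc n) = (a1 \<otimes> a2 [^] ?n) \<otimes> a2"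
      by (simp add: int_pow_join m_assoc)
    also have "\<dots> = a2 [^] ?n \<otimes> a1 \<otimes> b [^] ?n \<otimes> (c2 [^] (?n * (?n - 1)) \<otimes> a2)"
      by (simp add: Suc.IH m_assoc)
    also have "\<dots> = a2 [^] ?n \<otimes> a1 \<otimes> (b [^] ?n \<otimes> a2 [^] (1 :: int)) \<otimes> c2 [^] (?n * (?n - 1))"
      by (simp add: c_central m_assoc)
    also have "\<dots> = a2 [^] ?n \<otimes> (a1 \<otimes> a2) \<otimes> b [^] ?n \<otimes> (c2 [^] (2 * ?n) \<otimes> c2 [^] (?n * (?n - 1)))"
      unfolding b_pow_a2_pow by (simp add: m_assoc)
    also have "c2 [^] (2 * ?n) \<otimes> c2 [^] (?n * (?n - 1)) = c2 [^] (int (Suc n) * (int (Suc n) - 1))"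
      by (simp add: int_pow_mult[symmetric] algebra_simps)
    also have "a2 [^] ?n \<otimes> (a1 \<otimes> a2) \<otimes> b [^] ?n = a2 [^] int (Suc n) \<otimes> a1 \<otimes> b [^] int (Suc n)"
      unfolding comm_a1_a2 by (simp add: int_pow_join m_assoc)
    finally show ?case .
  qed
  obtain n where n: "[j = int n] (mod int p)"
    using obtain_nat_cong[OF p_pos] cong_sym by metis
  have "c2 [^] (j * (j - 1)) = c2 [^] (int n * (int n - 1))"
    using n by (intro gen_pow_cong cong_mult cong_diff) auto
  then show ?thesis
    using * gen_pow_cong[OF _ n, of a2] gen_pow_cong[OF _ n, of b] by simp
qed

fun normal_form :: "coords \<Rightarrow> 'a" where
  "normal_form (j, i, k, l, m) = a2 [^] j \<otimes> a1 [^] i \<otimes> b [^] k \<otimes> c1 [^] l \<otimes> c2 [^] m"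

lemma normal_form_closed [simp]: "normal_form t \<in> carrier G"
  by (cases t) simp

lemma normal_form_cong:
  assumes "coords_cong p s t"
  shows "normal_form s = normal_form t"
proof -
  obtain j i k l m where s: "s = (j, i, k, l, m)" by (cases s)
  obtain j' i' k' l' m' where t: "t = (j', i', k', l', m')" by (cases t)
  have "a2 [^] j = a2 [^] j'" "a1 [^] i = a1 [^] i'" "b [^] k = b [^] k'"
      "c1 [^] l = c1 [^] l'" "c2 [^] m = c2 [^] m'"
    using assms unfolding s t by (auto intro!: gen_pow_cong)
  then show ?thesis
    by (simp add: s t)
qed

fun interp :: "phi6_gen \<Rightarrow> 'a" where
  "interp Alpha1 = a1"
| "interp Alpha2 = a2"
| "interp Beta = b"
| "interp Beta1 = b1"
| "interp Beta2 = b2"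

lemma interp_closed [simp]: "interp x \<in> carrier G"
  by (cases x) simp_all

text \<open>This is where the formulas of \<open>letter_act\<close> come from. A new
  \<open>a1\<close> passes \<open>a2 [^] j\<close>, leaving \<open>b [^] j\<close> and
  \<open>c2 [^] (j * (j - 1))\<close>; then \<open>b [^] j\<close> passes \<open>a1 [^] i\<close>,
  leaving \<open>c1 [^] (2 * j * i)\<close>. A new b passes both powers; \<open>b1\<close> and
  \<open>b2\<close> go straight to the end.\<close>

lemma normal_form_letter: "normal_form (letter_act (True, x) t) = interp x \<otimes> normal_form t"
proof -
  obtain j i k l m where t: "t = (j, i, k, l, m)" by (cases t)
  show ?thesis
  proof (cases x)
    case Alpha1
    have "a1 \<otimes> normal_form t = (a1 \<otimes> a2 [^] j) \<otimes> (a1 [^] i \<otimes> (b [^] k \<otimes> (c1 [^] l \<otimes> c2 [^] m)))"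
      unfolding t by (simp add: m_assoc)
    also have "\<dots> = a2 [^] j \<otimes> (a1 \<otimes> (b [^] j \<otimes> (c2 [^] (j * (j - 1)) \<otimes>
        (a1 [^] i \<otimes> (b [^] k \<otimes> (c1 [^] l \<otimes> c2 [^] m))))))"
      unfolding a1_a2_pow by (simp add: m_assoc)
    also have "\<dots> = a2 [^] j \<otimes> (a1 \<otimes> ((b [^] j \<otimes> a1 [^] i) \<otimes> (b [^] k \<otimes> (c1 [^] l \<otimes>
        (c2 [^] (j * (j - 1)) \<otimes> c2 [^] m)))))"
      by (simp add: c_pow_lcomm m_assoc)
    also have "\<dots> = a2 [^] j \<otimes> (a1 \<otimes> (a1 [^] i \<otimes> (b [^] j \<otimes> (c1 [^] (2 * j * i) \<otimes> (b [^] k \<otimes> (c1 [^] l \<otimes>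
        (c2 [^] (j * (j - 1)) \<otimes> c2 [^] m)))))))"
      unfolding b_pow_a1_pow by (simp add: m_assoc)
    also have "\<dots> = a2 [^] j \<otimes> (a1 [^] (1 + i) \<otimes> (b [^] (j + k) \<otimes> (c1 [^] (2 * j * i + l) \<otimes>
        c2 [^] (j * (j - 1) + m))))"
      by (simp add: c_pow_lcomm int_pow_join)
    also have "\<dots> = normal_form (letter_act (True, Alpha1) t)"
      unfolding t by (simp add: m_assoc algebra_simps)
    finally show ?thesis using Alpha1 by simp
  next
    case Alpha2
    then show ?thesis unfolding t by (simp add: m_assoc int_pow_join add.commute)
  next
    case Beta
    have "b \<otimes> normal_form t = (b [^] (1 :: int) \<otimes> a2 [^] j) \<otimes> (a1 [^] i \<otimes> (b [^] k \<otimes> (c1 [^] l \<otimes> c2 [^] m)))"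
      unfolding t by (simp add: m_assoc)
    also have "\<dots> = a2 [^] j \<otimes> ((b [^] (1 :: int) \<otimes> a1 [^] i) \<otimes> (b [^] k \<otimes> (c1 [^] l \<otimes>
        (c2 [^] (2 * j) \<otimes> c2 [^] m))))"
      unfolding b_pow_a2_pow by (simp add: c_pow_lcomm m_assoc)
    also have "\<dots> = a2 [^] j \<otimes> (a1 [^] i \<otimes> (b [^] (1 + k) \<otimes> (c1 [^] (2 * i + l) \<otimes>
        c2 [^] (2 * j + m))))"
      unfolding b_pow_a1_pow by (simp add: c_pow_lcomm m_assoc int_pow_join)
    also have "\<dots> = normal_form (letter_act (True, Beta) t)"
      unfolding t by (simp add: m_assoc algebra_simps)
    finally show ?thesis using Beta by simp
  next
    case Beta1
    have "b1 \<otimes> normal_form t = c1 [^] (2 :: int) \<otimes>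
        (a2 [^] j \<otimes> (a1 [^] i \<otimes> (b [^] k \<otimes> (c1 [^] l \<otimes> c2 [^] m))))"
      unfolding t using c_pow_2(1)[of 1] by (simp add: m_assoc)
    also have "\<dots> = a2 [^] j \<otimes> (a1 [^] i \<otimes> (b [^] k \<otimes> (c1 [^] (2 :: int) \<otimes> (c1 [^] l \<otimes> c2 [^] m))))"
      by (simp add: c_pow_lcomm)
    also have "\<dots> = normal_form (letter_act (True, Beta1) t)"
      unfolding t by (simp add: m_assoc int_pow_join add.commute)
    finally show ?thesis using Beta1 by simp
  next
    case Beta2
    have "b2 \<otimes> normal_form t = c2 [^] (2 :: int) \<otimes>
        (a2 [^] j \<otimes> (a1 [^] i \<otimes> (b [^] k \<otimes> (c1 [^] l \<otimes> c2 [^] m))))"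
      unfolding t using c_pow_2(2)[of 1] by (simp add: m_assoc)
    also have "\<dots> = a2 [^] j \<otimes> (a1 [^] i \<otimes> (b [^] k \<otimes> (c1 [^] l \<otimes> (c2 [^] (2 :: int) \<otimes> c2 [^] m))))"
      by (simp add: c_pow_lcomm)
    also have "\<dots> = normal_form (letter_act (True, Beta2) t)"
      unfolding t by (simp add: m_assoc int_pow_join add.commute)
    finally show ?thesis using Beta2 by simp
  qed
qed

fun word_interp :: "phi6_gen word \<Rightarrow> 'a" where
  "word_interp [] = \<one>"
| "word_interp ((e, x) # w) = (if e then interp x else inv (interp x)) \<otimes> word_interp w"

lemma word_interp_eq: "word_interp w = normal_form (word_coords w)"
proof (induction w)
  case Nil
  show ?case by simp
next
  case (Cons a w)
  obtain e x where a: "a = (e, x)" by (cases a)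
  show ?case
  proof (cases e)
    case True
    then show ?thesis using Cons.IH by (simp add: a normal_form_letter)
  next
    case False
    \<comment> \<open>Inverse letters need no collection of their own: on coordinates they undo the
      positive letters, and cancellation in the group does the rest.\<close>
    have "interp x \<otimes> normal_form (letter_act (False, x) (word_coords w)) = normal_form (word_coords w)"
      unfolding normal_form_letter[symmetric] using letter_act_cancel[of True x] by simp
    then have "inv (interp x) \<otimes> normal_form (word_coords w) = normal_form (letter_act (False, x) (word_coords w))"
      by (metis interp_closed inv_solve_left normal_form_closed)
    with False show ?thesis using Cons.IH by (simp add: a)
  qed
qed

end

section \<open>The commuting relation modulo the center\<close>

lemma pres_class_gen_inv:
  "pres_class R [(False, x)] = inv\<^bsub>presented_group R\<^esub> (pres_class R (gen x))"
proof -
  interpret group "presented_group R" by (rule group_presented_group)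
  have "pres_class R [(False, x)] \<otimes>\<^bsub>presented_group R\<^esub> pres_class R (gen x) = \<one>\<^bsub>presented_group R\<^esub>"
    using pres_eq.cancel[of R False x]
    by (simp add: gen_def presented_group_def[THEN arg_cong[where f = one]] pres_class_eq_iff)
  then show ?thesis
    by (rule inv_equality[symmetric]) (auto simp: presented_group_def)
qed

lemma pres_class_comm:
  "pres_class R (word_comm (gen x) (gen y)) =
    commutator (presented_group R) (pres_class R (gen x)) (pres_class R (gen y))"
  by (simp add: commutator_def pres_class_gen_inv[symmetric])
    (simp add: word_comm_def word_inv_def gen_def)

lemma pres_class_pow: "pres_class R (word_pow w n) = pres_class R w [^]\<^bsub>presented_group R\<^esub> n"
proof (induction n)
  case 0
  show ?case by (simp add: word_pow_def presented_group_def)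
next
  case (Suc n)
  interpret group "presented_group R" by (rule group_presented_group)
  have "pres_class R (word_pow w (Suc n))
      = pres_class R w \<otimes>\<^bsub>presented_group R\<^esub> pres_class R (word_pow w n)"
    by (simp add: word_pow_def)
  then show ?case
    using nat_pow_Suc2[of "pres_class R w" n] by (simp add: Suc.IH presented_group_def)
qed

lemma pres_class_closed [simp]: "pres_class R w \<in> carrier (presented_group R)"
  by (simp add: presented_group_def)

lemma (in group) commutator_eq_iff:
  assumes "x \<in> carrier G" "y \<in> carrier G" "z \<in> carrier G"
  shows "commutator G x y = z \<longleftrightarrow> x \<otimes> y = y \<otimes> x \<otimes> z"
proof -
  have "commutator G x y = inv (y \<otimes> x) \<otimes> (x \<otimes> y)"
    using assms by (simp add: commutator_def inv_mult_group m_assoc)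
  then show ?thesis
    using assms by (metis inv_solve_left m_closed)
qed

lemma (in group) commutator_eq_one_iff:
  assumes "x \<in> carrier G" "y \<in> carrier G"
  shows "commutator G x y = \<one> \<longleftrightarrow> x \<otimes> y = y \<otimes> x"
  using assms by (simp add: commutator_eq_iff)

abbreviation phi6_class :: "nat \<Rightarrow> phi6_gen word \<Rightarrow> phi6_gen word set" where
  "phi6_class p \<equiv> pres_class (phi6_rels p)"

lemma group_phi6: "group (phi6_1_5 p)"
  unfolding phi6_1_5_def by (rule group_presented_group)

lemma phi6_presentation_phi6:
  assumes "odd p"
  shows "phi6_presentation (phi6_1_5 p) p
    (phi6_class p (gen Alpha1)) (phi6_class p (gen Alpha2)) (phi6_class p (gen Beta))
    (phi6_class p (gen Beta1)) (phi6_class p (gen Beta2))"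
proof -
  let ?H = "presented_group (phi6_rels p)" and ?c = "\<lambda>x. phi6_class p (gen x)"
  interpret group ?H by (rule group_presented_group)
  have one: "\<one>\<^bsub>?H\<^esub> = phi6_class p []"
    by (simp add: presented_group_def)
  have rel: "phi6_class p u = phi6_class p v" if "(u, v) \<in> phi6_rels p" for u v
    using that by (simp add: pres_class_eq_iff pres_eq.rel)
  have comm: "?c x \<otimes>\<^bsub>?H\<^esub> ?c y = ?c y \<otimes>\<^bsub>?H\<^esub> ?c x \<otimes>\<^bsub>?H\<^esub> ?c z" if "(x, y, z) \<in> phi6_comms" for x y z
  proof -
    have "commutator ?H (?c x) (?c y) = ?c z"
      unfolding pres_class_comm[symmetric] using that by (intro rel) (auto simp: phi6_rels_def)
    then show ?thesis by (simp only: commutator_eq_iff pres_class_closed)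
  qed
  have commute: "?c x \<otimes>\<^bsub>?H\<^esub> ?c y = ?c y \<otimes>\<^bsub>?H\<^esub> ?c x"
    if "\<nexists>z. (x, y, z) \<in> phi6_comms \<or> (y, x, z) \<in> phi6_comms" for x y
  proof -
    have "commutator ?H (?c x) (?c y) = \<one>\<^bsub>?H\<^esub>"
      unfolding pres_class_comm[symmetric] one
      using that by (intro rel) (auto simp only: phi6_rels_def)
    then show ?thesis by (simp only: commutator_eq_one_iff pres_class_closed)
  qed
  have pow: "?c x [^]\<^bsub>?H\<^esub> p = \<one>\<^bsub>?H\<^esub>" for x
    unfolding pres_class_pow[symmetric] one by (intro rel) (auto simp: phi6_rels_def)
  show ?thesis
    unfolding phi6_1_5_def
  proof (intro phi6_presentation.intro phi6_presentation_axioms.intro is_group)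
    show "odd p" by fact
    show "?c Alpha1 \<otimes>\<^bsub>?H\<^esub> ?c Alpha2 = ?c Alpha2 \<otimes>\<^bsub>?H\<^esub> ?c Alpha1 \<otimes>\<^bsub>?H\<^esub> ?c Beta"
      "?c Beta \<otimes>\<^bsub>?H\<^esub> ?c Alpha1 = ?c Alpha1 \<otimes>\<^bsub>?H\<^esub> ?c Beta \<otimes>\<^bsub>?H\<^esub> ?c Beta1"
      "?c Beta \<otimes>\<^bsub>?H\<^esub> ?c Alpha2 = ?c Alpha2 \<otimes>\<^bsub>?H\<^esub> ?c Beta \<otimes>\<^bsub>?H\<^esub> ?c Beta2"
      by (intro comm; simp add: phi6_comms_def)+
    show "?c Beta1 \<otimes>\<^bsub>?H\<^esub> X = X \<otimes>\<^bsub>?H\<^esub> ?c Beta1"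
      if "X \<in> {?c Alpha1, ?c Alpha2, ?c Beta, ?c Beta2}" for X
    proof -
      from that obtain x where "X = ?c x" "x \<in> {Alpha1, Alpha2, Beta, Beta2}" by blast
      then show ?thesis
        by (simp del: mult_pres_class, intro commute) (auto simp: phi6_comms_def)
    qed
    show "?c Beta2 \<otimes>\<^bsub>?H\<^esub> X = X \<otimes>\<^bsub>?H\<^esub> ?c Beta2"
      if "X \<in> {?c Alpha1, ?c Alpha2, ?c Beta, ?c Beta1}" for X
    proof -
      from that obtain x where "X = ?c x" "x \<in> {Alpha1, Alpha2, Beta, Beta1}" by blast
      then show ?thesis
        by (simp del: mult_pres_class, intro commute) (auto simp: phi6_comms_def)
    qed
    show "X [^]\<^bsub>?H\<^esub> p = \<one>\<^bsub>?H\<^esub>"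
      if "X \<in> {?c Alpha1, ?c Alpha2, ?c Beta, ?c Beta1, ?c Beta2}" for X
      using that pow by auto
  qed simp_all
qed

text \<open>Relations preserve coordinates modulo p, which gives one direction. Conversely,
  evaluating a word at the generators themselves returns its class, and collection shows that this
  value depends only on the coordinates modulo p.\<close>

lemma phi6_class_eq_iff:
  assumes "odd p"
  shows "phi6_class p u = phi6_class p v \<longleftrightarrow> coords_cong p (word_coords u) (word_coords v)"
proof
  assume "phi6_class p u = phi6_class p v"
  then show "coords_cong p (word_coords u) (word_coords v)"
    by (simp add: pres_class_eq_iff word_coords_cong)
next
  interpret phi6_presentation "phi6_1_5 p" p "phi6_class p (gen Alpha1)" "phi6_class p (gen Alpha2)"
    "phi6_class p (gen Beta)" "phi6_class p (gen Beta1)" "phi6_class p (gen Beta2)"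
    by (rule phi6_presentation_phi6[OF assms])
  have gen: "interp x = phi6_class p (gen x)" for x
    by (cases x) simp_all
  have one: "\<one>\<^bsub>phi6_1_5 p\<^esub> = phi6_class p []"
    and mult: "phi6_class p u \<otimes>\<^bsub>phi6_1_5 p\<^esub> phi6_class p v = phi6_class p (u @ v)"
    and inv: "inv\<^bsub>phi6_1_5 p\<^esub> phi6_class p (gen x) = phi6_class p [(False, x)]" for u v x
    by (simp_all add: phi6_1_5_def pres_class_gen_inv) (simp add: presented_group_def)
  have interp: "word_interp w = phi6_class p w" for w
  proof (induction w)
    case Nil
    show ?case by (simp add: one)
  next
    case (Cons a w)
    obtain e x where a: "a = (e, x)" by (cases a)
    show ?case
      using Cons.IH unfolding a
      by (cases e) (simp_all add: gen inv mult, simp add: gen_def)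
  qed
  assume "coords_cong p (word_coords u) (word_coords v)"
  then have "normal_form (word_coords u) = normal_form (word_coords v)"
    by (rule normal_form_cong)
  then show "phi6_class p u = phi6_class p v"
    by (simp only: word_interp_eq[symmetric] interp)
qed

section \<open>Commuting as linear dependence modulo p\<close>

type_synonym vec3 = "int \<times> int \<times> int"

text \<open>The shift of the third entry turns the commuting relation modulo the center into
  linear dependence over the field with \<open>p\<close> elements.\<close>

fun coords_vec :: "coords \<Rightarrow> vec3" where
  "coords_vec (j, i, k, l, m) = (i, j, 2 * k - i * j)"

text \<open>Linear dependence expressed by vanishing 2x2 minors. In this form it is symmetric,
  polynomial, and makes the zero vector parallel to everything.\<close>

fun parallel :: "nat \<Rightarrow> vec3 \<Rightarrow> vec3 \<Rightarrow> bool" where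
  "parallel p (x, y, z) (x', y', z') \<longleftrightarrow>
    [x * y' = x' * y] (mod int p) \<and> [z * x' = z' * x] (mod int p) \<and> [z * y' = z' * y] (mod int p)"

fun vec_cong :: "nat \<Rightarrow> vec3 \<Rightarrow> vec3 \<Rightarrow> bool" where
  "vec_cong p (x, y, z) (x', y', z') \<longleftrightarrow>
    [x = x'] (mod int p) \<and> [y = y'] (mod int p) \<and> [z = z'] (mod int p)"

lemma coords_mult_commute_iff:
  "coords_cong p (coords_mult s t) (coords_mult t s) \<longleftrightarrow> parallel p (coords_vec s) (coords_vec t)"
proof -
  obtain j i k l m where s: "s = (j, i, k, l, m)" by (cases s)
  obtain j' i' k' l' m' where t: "t = (j', i', k', l', m')" by (cases t)
  define d where "d = i * j' - i' * j"
  define P where "P = int p"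
  have dvd_shift: "P dvd d \<Longrightarrow> a = b + d * c \<Longrightarrow> P dvd a \<longleftrightarrow> P dvd b" for a b c
    by (simp add: dvd_add_left_iff)
  \<comment> \<open>The third entries of the two products differ by d. The fourth entries differ by
    the minor (2 k - i j) i' - (2 k' - i' j') i plus d (i + i' - 1), and the last summand drops out
    once p divides d. The fifth entries behave alike with j for i.\<close>
  have l: "P dvd (l + l' + 2 * k * i' + 2 * i * i' * j' + j' * i * (i - 1))
        - (l' + l + 2 * k' * i + 2 * i' * i * j + j * i' * (i' - 1)) \<longleftrightarrow>
      P dvd (2 * k - i * j) * i' - (2 * k' - i' * j') * i" if "P dvd d"
    by (rule dvd_shift[OF that, where c = "i + i' - 1"]) (simp add: d_def algebra_simps)
  have m: "P dvd (m + m' + 2 * k * j' + i * j' * (j' - 1))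
        - (m' + m + 2 * k' * j + i' * j * (j - 1)) \<longleftrightarrow>
      P dvd (2 * k - i * j) * j' - (2 * k' - i' * j') * j" if "P dvd d"
    by (rule dvd_shift[OF that, where c = "j + j' - 1"]) (simp add: d_def algebra_simps)
  have k: "k + k' + i * j' - (k' + k + i' * j) = d" "i * j' - i' * j = d"
    by (simp_all add: d_def)
  show ?thesis
    unfolding s t coords_mult.simps coords_vec.simps coords_cong.simps parallel.simps cong_iff_dvd_diff
      P_def[symmetric] k
    using l m by (auto simp: add.commute)
qed

lemma phi6_commute_iff:
  assumes "odd p"
  shows "phi6_class p u \<otimes>\<^bsub>phi6_1_5 p\<^esub> phi6_class p v = phi6_class p v \<otimes>\<^bsub>phi6_1_5 p\<^esub> phi6_class p u
    \<longleftrightarrow> parallel p (coords_vec (word_coords u)) (coords_vec (word_coords v))"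
  by (simp add: phi6_1_5_def phi6_class_eq_iff[OF assms] word_coords_append coords_mult_commute_iff
    del: foldr_append)

lemma carrier_phi6: "carrier (phi6_1_5 p) = range (phi6_class p)"
  by (simp add: phi6_1_5_def presented_group_def)

lemma phi6_central_iff:
  assumes "odd p"
  shows "phi6_class p u \<in> center (phi6_1_5 p) \<longleftrightarrow> vec_cong p (coords_vec (word_coords u)) (0, 0, 0)"
proof -
  obtain x y z where v: "coords_vec (word_coords u) = (x, y, z)"
    by (cases "coords_vec (word_coords u)")
  have "phi6_class p u \<in> center (phi6_1_5 p) \<longleftrightarrow>
      (\<forall>w. parallel p (x, y, z) (coords_vec (word_coords w)))"
    by (auto simp: center_def carrier_phi6 phi6_commute_iff[OF assms] v)
  also have "\<dots> \<longleftrightarrow> vec_cong p (x, y, z) (0, 0, 0)"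
  proof
    assume "\<forall>w. parallel p (x, y, z) (coords_vec (word_coords w))"
    \<comment> \<open>The vectors of these generators are (1, 0, 0) and (0, 1, 0); being parallel to
      both forces all three entries to vanish.\<close>
    from spec[OF this, of "gen Alpha1"] spec[OF this, of "gen Alpha2"]
    show "vec_cong p (x, y, z) (0, 0, 0)"
      by (auto simp: gen_def cong_sym_eq)
  next
    assume "vec_cong p (x, y, z) (0, 0, 0)"
    then have "parallel p (x, y, z) (x', y', z')" for x' y' z'
      by (simp add: cong_0_iff cong_iff_dvd_diff)
    then show "\<forall>w. parallel p (x, y, z) (coords_vec (word_coords w))"
      by (metis prod_cases3)
  qed
  finally show ?thesis by (simp only: v)
qed

lemma center_iff: "z \<in> center G \<longleftrightarrow> z \<in> carrier G \<and> (\<forall>x\<in>carrier G. z \<otimes>\<^bsub>G\<^esub> x = x \<otimes>\<^bsub>G\<^esub> z)"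
  unfolding center_def by blast

lemma (in group) subgroup_center: "subgroup (center G) G"
proof (rule subgroupI)
  show "center G \<subseteq> carrier G" by (rule center_subset)
  have "\<one> \<in> center G" by (simp add: center_def)
  then show "center G \<noteq> {}" by blast
  show "inv a \<in> center G" if "a \<in> center G" for a
    using that unfolding center_iff by (blast intro: commute_inv)
  show "a \<otimes> b \<in> center G" if a: "a \<in> center G" and b: "b \<in> center G" for a b
  proof -
    have car: "a \<in> carrier G" "b \<in> carrier G" using a b center_subset by auto
    have "a \<otimes> b \<otimes> x = x \<otimes> (a \<otimes> b)" if x: "x \<in> carrier G" for x
    proof -
      have "b \<otimes> x = x \<otimes> b" "a \<otimes> x = x \<otimes> a"
        using a b x unfolding center_iff by blast+
      then show ?thesis
        using car x by (metis m_assoc)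
    qed
    with car show ?thesis unfolding center_iff by blast
  qed
qed

lemma (in group) rcos_eq_iff:
  assumes "subgroup H G" "x \<in> carrier G" "y \<in> carrier G"
  shows "H #> x = H #> y \<longleftrightarrow> x \<otimes> inv y \<in> H"
proof
  assume "H #> x = H #> y"
  then have "x \<in> H #> y"
    using rcos_self[OF assms(2,1)] by simp
  then show "x \<otimes> inv y \<in> H"
    using subgroup.rcos_module[OF assms(1) is_group assms(3,2)] by simp
next
  assume "x \<otimes> inv y \<in> H"
  then have "x \<in> H #> y"
    using subgroup.rcos_module[OF assms(1) is_group assms(3,2)] by simp
  then show "H #> x = H #> y"
    using repr_independence[OF _ assms(3,1)] by simp
qed

text \<open>\<open>coords_vec\<close> is not additive: the third entry of a product has the extra
  term i'' j' - i' j''. This term vanishes as soon as i'' and j'' do, which the first two entries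
  already enforce.\<close>

lemma coords_vec_mult_cong_iff:
  assumes "coords_cong p s (coords_mult r t)"
  shows "vec_cong p (coords_vec s) (coords_vec t) \<longleftrightarrow> vec_cong p (coords_vec r) (0, 0, 0)"
proof -
  obtain j i k l m where s: "s = (j, i, k, l, m)" by (cases s)
  obtain j' i' k' l' m' where t: "t = (j', i', k', l', m')" by (cases t)
  obtain j'' i'' k'' l'' m'' where r: "r = (j'', i'', k'', l'', m'')" by (cases r)
  have *: "[j = j'' + j'] (mod int p)" "[i = i'' + i'] (mod int p)" "[k = k'' + k' + i'' * j'] (mod int p)"
    using assms by (auto simp: s t r)
  have ij: "[i = i'] (mod int p) \<longleftrightarrow> [i'' = 0] (mod int p)" "[j = j'] (mod int p) \<longleftrightarrow> [j'' = 0] (mod int p)"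
    using * cong_add_rcancel_0[of i'' i' "int p"] cong_add_rcancel_0[of j'' j' "int p"]
    by (auto intro: cong_trans cong_sym)
  have "[2 * k - i * j = 2 * k' - i' * j'] (mod int p) \<longleftrightarrow> [2 * k'' - i'' * j'' = 0] (mod int p)"
    if i: "[i'' = 0] (mod int p)" and j: "[j'' = 0] (mod int p)"
  proof -
    have "[2 * k - i * j = 2 * (k'' + k' + i'' * j') - (i'' + i') * (j'' + j')] (mod int p)"
      using * by (intro cong_diff cong_mult) auto
    moreover have "[2 * (k'' + k' + i'' * j') - (i'' + i') * (j'' + j')
        = 2 * k'' - i'' * j'' + (2 * k' - i' * j')] (mod int p)"
      using i j by (auto simp: cong_iff_dvd_diff algebra_simps)
    ultimately have "[2 * k - i * j = 2 * k'' - i'' * j'' + (2 * k' - i' * j')] (mod int p)"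
      by (rule cong_trans)
    then show ?thesis
      using cong_add_rcancel_0[of "2 * k'' - i'' * j''" "2 * k' - i' * j'" "int p"]
      by (auto intro: cong_trans cong_sym)
  qed
  with ij show ?thesis
    by (auto simp: s t r)
qed

lemma phi6_coset_eq_iff:
  assumes "odd p"
  shows "center (phi6_1_5 p) #>\<^bsub>phi6_1_5 p\<^esub> phi6_class p u
      = center (phi6_1_5 p) #>\<^bsub>phi6_1_5 p\<^esub> phi6_class p v
    \<longleftrightarrow> vec_cong p (coords_vec (word_coords u)) (coords_vec (word_coords v))"
proof -
  interpret group "phi6_1_5 p" by (rule group_phi6)
  have car: "phi6_class p w \<in> carrier (phi6_1_5 p)" for w
    by (simp add: carrier_phi6)
  obtain w where w: "phi6_class p u \<otimes>\<^bsub>phi6_1_5 p\<^esub> inv\<^bsub>phi6_1_5 p\<^esub> phi6_class p v = phi6_class p w"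
    using m_closed[OF car[of u] inv_closed[OF car[of v]]] unfolding carrier_phi6 by auto
  then have "phi6_class p u = phi6_class p w \<otimes>\<^bsub>phi6_1_5 p\<^esub> phi6_class p v"
    using car by (metis inv_solve_right m_closed inv_closed)
  then have "phi6_class p u = phi6_class p (w @ v)"
    by (simp add: phi6_1_5_def)
  then have "coords_cong p (word_coords u) (coords_mult (word_coords w) (word_coords v))"
    unfolding phi6_class_eq_iff[OF assms] word_coords_append .
  then show ?thesis
    unfolding rcos_eq_iff[OF subgroup_center car car] w phi6_central_iff[OF assms]
    by (rule coords_vec_mult_cong_iff[symmetric])
qed

lemma coords_vec_surj:
  assumes "odd p"
  shows "\<exists>w. vec_cong p (coords_vec (word_coords w)) (x, y, z)"
proof -
  have p: "p > 0" using assms by (cases p) auto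
  obtain i j where i: "[int i = x] (mod int p)" and j: "[int j = y] (mod int p)"
    using obtain_nat_cong[OF p] by metis
  \<comment> \<open>h is one half modulo p, so k = (z + x y) / 2 solves 2 k - x y = z.\<close>
  obtain h where h: "p + 1 = 2 * h" using assms by (metis even_Suc dvdE Suc_eq_plus1)
  obtain k where k: "[int k = int h * (z + x * y)] (mod int p)"
    using obtain_nat_cong[OF p] by metis
  let ?w = "word_pow (gen Alpha2) j @ word_pow (gen Alpha1) i @ word_pow (gen Beta) k"
  have "coords_vec (word_coords ?w) = (int i, int j, 2 * int k - int i * int j)"
    by (simp add: word_act_pow_gen)
  moreover have "[2 * int k - int i * int j = 2 * (int h * (z + x * y)) - x * y] (mod int p)"
    using i j k by (intro cong_diff cong_mult) auto
  moreover have "2 * int h = int p + 1"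
    using h by linarith
  then have "2 * (int h * (z + x * y)) = (int p + 1) * (z + x * y)"
    by (simp only: mult.assoc[symmetric])
  then have "2 * (int h * (z + x * y)) - x * y = z + int p * (z + x * y)"
    by (simp only: distrib_right) simp
  then have "[2 * (int h * (z + x * y)) - x * y = z] (mod int p)"
    by (simp add: cong_def)
  ultimately have "vec_cong p (coords_vec (word_coords ?w)) (x, y, z)"
    using i j cong_trans by auto
  then show ?thesis ..
qed

section \<open>Lines in the three-dimensional space over the field with p elements\<close>

lemma prime_cross_cong:
  fixes a a' :: int
  assumes p: "prime p" and a: "\<not> [a = 0] (mod int p)"
  obtains n where "n \<in> {0..<int p}"
    and "\<And>c c'. [a * c' = a' * c] (mod int p) \<Longrightarrow> [c' = n * c] (mod int p)"
proof -
  have "coprime a (int p)"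
    using p a by (metis cong_0_iff coprime_commute prime_imp_coprime prime_nat_int_transfer)
  then obtain d where d: "[a * d = 1] (mod int p)"
    using cong_solve_coprime_int by blast
  show thesis
  proof
    \<comment> \<open>The scalar is a' / a. It does not depend on c and c', so one scalar serves all
      entries of a vector.\<close>
    show "(d * a') mod int p \<in> {0..<int p}"
      using p by (simp add: prime_gt_0_nat)
    fix c c' assume "[a * c' = a' * c] (mod int p)"
    then have "[d * (a' * c) = d * (a * c')] (mod int p)"
      by (metis cong_scalar_left cong_sym)
    moreover have "[(a * d) * c' = 1 * c'] (mod int p)"
      using d by (rule cong_scalar_right)
    ultimately have "[d * a' * c = c'] (mod int p)"
      by (simp add: mult_ac) (metis cong_trans)
    moreover have "[(d * a') mod int p * c = d * a' * c] (mod int p)"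
      by (intro cong_scalar_right) simp
    ultimately show "[c' = (d * a') mod int p * c] (mod int p)"
      by (metis cong_sym cong_trans)
  qed
qed

text \<open>A nonzero entry of (x, y, z) serves as pivot: its quotient with the corresponding entry
  of the other vector is the scalar, and the minors containing the pivot give the remaining
  entries.\<close>

lemma parallel_imp_multiple:
  assumes p: "prime p" and nz: "\<not> vec_cong p (x, y, z) (0, 0, 0)"
    and par: "parallel p (x, y, z) (x', y', z')"
  obtains n where "n \<in> {0..<int p}" "vec_cong p (x', y', z') (n * x, n * y, n * z)"
proof -
  have xy: "[x * y' = x' * y] (mod int p)" "[y * x' = y' * x] (mod int p)"
    and xz: "[x * z' = x' * z] (mod int p)" "[z * x' = z' * x] (mod int p)"
    and yz: "[y * z' = y' * z] (mod int p)" "[z * y' = z' * y] (mod int p)"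
    using par by (simp_all add: mult.commute cong_sym_eq)
  consider "\<not> [x = 0] (mod int p)" | "\<not> [y = 0] (mod int p)" | "\<not> [z = 0] (mod int p)"
    using nz by auto
  then show thesis
  proof cases
    case 1
    obtain n where n: "n \<in> {0..<int p}"
      and cross: "\<And>c c'. [x * c' = x' * c] (mod int p) \<Longrightarrow> [c' = n * c] (mod int p)"
      using prime_cross_cong[OF p 1, of x'] by blast
    have self: "[x * x' = x' * x] (mod int p)"
      by (simp add: mult.commute)
    have "vec_cong p (x', y', z') (n * x, n * y, n * z)"
      using cross[OF self] cross[OF xy(1)] cross[OF xz(1)] by simp
    with n show thesis by (rule that)
  next
    case 2
    obtain n where n: "n \<in> {0..<int p}"
      and cross: "\<And>c c'. [y * c' = y' * c] (mod int p) \<Longrightarrow> [c' = n * c] (mod int p)"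
      using prime_cross_cong[OF p 2, of y'] by blast
    have self: "[y * y' = y' * y] (mod int p)"
      by (simp add: mult.commute)
    have "vec_cong p (x', y', z') (n * x, n * y, n * z)"
      using cross[OF self] cross[OF xy(2)] cross[OF yz(1)] by simp
    with n show thesis by (rule that)
  next
    case 3
    obtain n where n: "n \<in> {0..<int p}"
      and cross: "\<And>c c'. [z * c' = z' * c] (mod int p) \<Longrightarrow> [c' = n * c] (mod int p)"
      using prime_cross_cong[OF p 3, of z'] by blast
    have self: "[z * z' = z' * z] (mod int p)"
      by (simp add: mult.commute)
    have "vec_cong p (x', y', z') (n * x, n * y, n * z)"
      using cross[OF self] cross[OF xz(2)] cross[OF yz(2)] by simp
    with n show thesis by (rule that)
  qed
qed

text \<open>Both v and w are multiples of the nonzero vector u. This is what makes noncentral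
  centralizers abelian.\<close>

lemma parallel_trans:
  assumes p: "prime p" and nz: "\<not> vec_cong p u (0, 0, 0)"
    and "parallel p u v" "parallel p u w"
  shows "parallel p v w"
proof -
  obtain x y z where u: "u = (x, y, z)" by (cases u)
  obtain x' y' z' where v: "v = (x', y', z')" by (cases v)
  obtain x'' y'' z'' where w: "w = (x'', y'', z'')" by (cases w)
  obtain n where n: "vec_cong p v (n * x, n * y, n * z)"
    using parallel_imp_multiple[OF p, of x y z x' y' z'] assms unfolding u v by blast
  obtain m where m: "vec_cong p w (m * x, m * y, m * z)"
    using parallel_imp_multiple[OF p, of x y z x'' y'' z''] assms unfolding u w by blast
  have *: "[a * b' = b * a'] (mod int p)"
    if "[a = n * c] (mod int p)" "[b = m * c] (mod int p)"
      "[a' = n * c'] (mod int p)" "[b' = m * c'] (mod int p)" for a b a' b' c c'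
  proof -
    have "[a * b' = (n * c) * (m * c')] (mod int p)" "[b * a' = (m * c) * (n * c')] (mod int p)"
      using that by (auto intro: cong_mult)
    then show ?thesis
      by (simp add: mult_ac) (metis cong_sym cong_trans)
  qed
  show ?thesis
    using n m unfolding v w by (auto intro: *)
qed

text \<open>Canonical representatives turn congruence into equality, so that vectors can be
  counted.\<close>

fun vec_mod :: "nat \<Rightarrow> vec3 \<Rightarrow> vec3" where
  "vec_mod p (x, y, z) = (x mod int p, y mod int p, z mod int p)"

definition vecs :: "nat \<Rightarrow> vec3 set" where
  "vecs p = {0..<int p} \<times> {0..<int p} \<times> {0..<int p}"

lemma vec_mod_eq_iff: "vec_mod p v = vec_mod p w \<longleftrightarrow> vec_cong p v w"
  by (cases v; cases w) (simp add: cong_def)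

lemma vec_mod_id: "v \<in> vecs p \<Longrightarrow> vec_mod p v = v"
  by (auto simp: vecs_def)

lemma vec_mod_in_vecs: "p > 0 \<Longrightarrow> vec_mod p v \<in> vecs p"
  by (cases v) (auto simp: vecs_def)

lemma parallel_vec_mod: "parallel p (vec_mod p v) (vec_mod p w) \<longleftrightarrow> parallel p v w"
  by (cases v; cases w) (simp add: cong_def mod_mult_eq)

lemma card_vecs: "card (vecs p) = p ^ 3"
  by (simp add: vecs_def card_cartesian_product power3_eq_cube)

text \<open>The vectors parallel to v are its multiples by the p scalars, which are distinct because
  some entry of v can be cancelled modulo p.\<close>

lemma card_parallel:
  assumes p: "prime p" and v: "v \<in> vecs p" "v \<noteq> (0, 0, 0)"
  shows "card {w \<in> vecs p. parallel p v w} = p"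
proof -
  obtain x y z where xyz: "v = (x, y, z)" by (cases v)
  have p0: "p > 0" using p by (rule prime_gt_0_nat)
  have "(0, 0, 0) \<in> vecs p" using p0 by (simp add: vecs_def)
  then have nz: "\<not> vec_cong p v (0, 0, 0)"
    using v unfolding vec_mod_eq_iff[symmetric] by (simp add: vec_mod_id del: vec_mod.simps)
  let ?f = "\<lambda>n. vec_mod p (n * x, n * y, n * z)"
  have "bij_betw ?f {0..<int p} {w \<in> vecs p. parallel p v w}"
  proof (rule bij_betw_imageI)
    show "inj_on ?f {0..<int p}"
    proof (rule inj_onI)
      fix m n assume mn: "m \<in> {0..<int p}" "n \<in> {0..<int p}" and eq: "?f m = ?f n"
      from nz obtain c where c: "c \<in> {x, y, z}" "\<not> [c = 0] (mod int p)"
        by (auto simp: xyz)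
      then have "[m * c = n * c] (mod int p)"
        using eq unfolding vec_mod_eq_iff by auto
      moreover have "coprime c (int p)"
        using p c(2) by (metis cong_0_iff coprime_commute prime_imp_coprime prime_nat_int_transfer)
      ultimately have "[m = n] (mod int p)"
        using cong_mult_rcancel by blast
      with mn show "m = n"
        by (simp add: cong_def)
    qed
    show "?f ` {0..<int p} = {w \<in> vecs p. parallel p v w}"
    proof (intro equalityI subsetI)
      fix w assume "w \<in> ?f ` {0..<int p}"
      then obtain n where w: "w = ?f n" by blast
      have "parallel p v (n * x, n * y, n * z)"
        by (simp add: xyz mult_ac)
      then have "parallel p (vec_mod p v) (vec_mod p (n * x, n * y, n * z))"
        unfolding parallel_vec_mod .
      then show "w \<in> {w \<in> vecs p. parallel p v w}"
        using vec_mod_in_vecs[OF p0] v(1) unfolding w by (simp add: vec_mod_id del: vec_mod.simps)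
    next
      fix w assume w: "w \<in> {w \<in> vecs p. parallel p v w}"
      obtain x' y' z' where w': "w = (x', y', z')" by (cases w)
      obtain n where n: "n \<in> {0..<int p}" "vec_cong p w (n * x, n * y, n * z)"
        using parallel_imp_multiple[OF p, of x y z x' y' z'] w nz unfolding xyz w' by blast
      then have "w = ?f n"
        using w unfolding vec_mod_eq_iff[symmetric] by (simp add: vec_mod_id del: vec_mod.simps)
      with n(1) show "w \<in> ?f ` {0..<int p}" by blast
    qed
  qed
  then show ?thesis
    by (simp add: bij_betw_same_card[symmetric])
qed

section \<open>Transport along the isoclinism and the final count\<close>

lemma (in group) commutator_in_derived:
  assumes "x \<in> carrier G" "y \<in> carrier G"
  shows "commutator G x y \<in> derived G (carrier G)"
proof -
  have "commutator G x y = inv x \<otimes> inv y \<otimes> inv (inv x) \<otimes> inv (inv y)"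
    using assms by (simp add: commutator_def)
  then show ?thesis
    using assms unfolding derived_def by (intro generate.incl) blast
qed

text \<open>All that the count takes from the isoclinism. \<theta> makes the fibres of f the cosets
  of the center; \<phi> is injective and preserves the identity, so a commutator is trivial in G
  exactly when its counterpart is trivial in the presented group.\<close>

lemma isoclinic_phi6_vec:
  assumes G: "group G" and p: "odd p" and iso: "isoclinic G (phi6_1_5 p)"
  obtains f where "f ` carrier G = vecs p"
    and "\<And>g h. g \<in> carrier G \<Longrightarrow> h \<in> carrier G \<Longrightarrow>
      f g = f h \<longleftrightarrow> center G #>\<^bsub>G\<^esub> g = center G #>\<^bsub>G\<^esub> h"
    and "\<And>g h. g \<in> carrier G \<Longrightarrow> h \<in> carrier G \<Longrightarrow>
      g \<otimes>\<^bsub>G\<^esub> h = h \<otimes>\<^bsub>G\<^esub> g \<longleftrightarrow> parallel p (f g) (f h)"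
proof -
  let ?H = "phi6_1_5 p" and ?c = "phi6_class p" and ?v = "\<lambda>w. coords_vec (word_coords w)"
  interpret G: group G by fact
  interpret H: group ?H by (rule group_phi6)
  have p0: "p > 0" using p by (cases p) auto
  have c_car: "?c w \<in> carrier ?H" for w by (simp add: carrier_phi6)
  from iso obtain \<theta> \<phi> where \<theta>: "\<theta> \<in> iso (G Mod center G) (?H Mod center ?H)"
    and \<phi>: "\<phi> \<in> iso (derived_group G) (derived_group ?H)"
    and compat: "\<And>g1 g2 h1 h2. g1 \<in> carrier G \<Longrightarrow> g2 \<in> carrier G \<Longrightarrow> h1 \<in> carrier ?H \<Longrightarrow>
      h2 \<in> carrier ?H \<Longrightarrow> \<theta> (center G #>\<^bsub>G\<^esub> g1) = center ?H #>\<^bsub>?H\<^esub> h1 \<Longrightarrow>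
      \<theta> (center G #>\<^bsub>G\<^esub> g2) = center ?H #>\<^bsub>?H\<^esub> h2 \<Longrightarrow>
      \<phi> (commutator G g1 g2) = commutator ?H h1 h2"
    unfolding isoclinic_def by meson
  have \<theta>_bij: "bij_betw \<theta> (rcosets\<^bsub>G\<^esub> center G) (rcosets\<^bsub>?H\<^esub> center ?H)"
    using \<theta> by (simp add: iso_def FactGroup_def)
  have "\<exists>w. \<theta> (center G #>\<^bsub>G\<^esub> g) = center ?H #>\<^bsub>?H\<^esub> ?c w" if g: "g \<in> carrier G" for g
  proof -
    have "\<theta> (center G #>\<^bsub>G\<^esub> g) \<in> rcosets\<^bsub>?H\<^esub> center ?H"
      using bij_betwE[OF \<theta>_bij] G.rcosetsI[OF G.center_subset g] by blast
    then show ?thesis by (auto simp: RCOSETS_def carrier_phi6)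
  qed
  \<comment> \<open>\<open>W g\<close> is any word for a representative of the coset assigned to g.
    Its vector modulo p depends only on the coset, so f is insensitive to this choice.\<close>
  then obtain W where W: "\<And>g. g \<in> carrier G \<Longrightarrow> \<theta> (center G #>\<^bsub>G\<^esub> g) = center ?H #>\<^bsub>?H\<^esub> ?c (W g)"
    by metis
  define f where "f g = vec_mod p (?v (W g))" for g
  have "f ` carrier G = vecs p"
  proof (intro equalityI subsetI)
    show "v \<in> vecs p" if "v \<in> f ` carrier G" for v
      using that vec_mod_in_vecs[OF p0] unfolding f_def by blast
  next
    fix v assume v: "v \<in> vecs p"
    obtain w where w: "vec_cong p (?v w) v"
      using coords_vec_surj[OF p] by (cases v) blast
    have "center ?H #>\<^bsub>?H\<^esub> ?c w \<in> \<theta> ` (rcosets\<^bsub>G\<^esub> center G)"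
      using H.rcosetsI[OF H.center_subset c_car] bij_betw_imp_surj_on[OF \<theta>_bij] by simp
    then obtain g where g: "g \<in> carrier G" "\<theta> (center G #>\<^bsub>G\<^esub> g) = center ?H #>\<^bsub>?H\<^esub> ?c w"
      unfolding RCOSETS_def by auto
    then have "vec_cong p (?v (W g)) (?v w)"
      using W[OF g(1)] by (simp only: phi6_coset_eq_iff[OF p, symmetric])
    then have "f g = v"
      using w v unfolding f_def vec_mod_eq_iff[symmetric] by (simp add: vec_mod_id)
    with g(1) show "v \<in> f ` carrier G" by blast
  qed
  moreover have "f g = f h \<longleftrightarrow> center G #>\<^bsub>G\<^esub> g = center G #>\<^bsub>G\<^esub> h"
    if "g \<in> carrier G" "h \<in> carrier G" for g h
  proof -
    have "f g = f h \<longleftrightarrow> \<theta> (center G #>\<^bsub>G\<^esub> g) = \<theta> (center G #>\<^bsub>G\<^esub> h)"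
      unfolding f_def vec_mod_eq_iff W[OF that(1)] W[OF that(2)] phi6_coset_eq_iff[OF p] ..
    also have "\<dots> \<longleftrightarrow> center G #>\<^bsub>G\<^esub> g = center G #>\<^bsub>G\<^esub> h"
      using \<theta>_bij that by (intro inj_on_eq_iff[where A = "rcosets\<^bsub>G\<^esub> center G"])
        (auto simp: bij_betw_def RCOSETS_def)
    finally show ?thesis .
  qed
  moreover have "g \<otimes>\<^bsub>G\<^esub> h = h \<otimes>\<^bsub>G\<^esub> g \<longleftrightarrow> parallel p (f g) (f h)"
    if g: "g \<in> carrier G" and h: "h \<in> carrier G" for g h
  proof -
    interpret DG: group "derived_group G"
      by (intro subgroup.subgroup_is_group G.derived_is_subgroup G.is_group) simp
    interpret DH: group "derived_group ?H"
      by (intro subgroup.subgroup_is_group H.derived_is_subgroup H.is_group) simp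
    have \<phi>1: "\<phi> \<one>\<^bsub>G\<^esub> = \<one>\<^bsub>?H\<^esub>"
      using hom_one[of \<phi> "derived_group G" "derived_group ?H"] \<phi> DG.is_group DH.is_group
      by (simp add: iso_def)
    have inj: "inj_on \<phi> (derived G (carrier G))"
      using \<phi> by (simp add: iso_def bij_betw_def)
    have one: "\<one>\<^bsub>G\<^esub> \<in> derived G (carrier G)"
      using DG.one_closed by simp
    have "g \<otimes>\<^bsub>G\<^esub> h = h \<otimes>\<^bsub>G\<^esub> g \<longleftrightarrow> commutator G g h = \<one>\<^bsub>G\<^esub>"
      using g h by (simp only: G.commutator_eq_one_iff)
    also have "\<dots> \<longleftrightarrow> \<phi> (commutator G g h) = \<phi> \<one>\<^bsub>G\<^esub>"
      using inj_on_eq_iff[OF inj G.commutator_in_derived[OF g h] one] by simp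
    also have "\<dots> \<longleftrightarrow> commutator ?H (?c (W g)) (?c (W h)) = \<one>\<^bsub>?H\<^esub>"
      unfolding compat[OF g h c_car c_car W[OF g] W[OF h]] \<phi>1 ..
    also have "\<dots> \<longleftrightarrow> parallel p (?v (W g)) (?v (W h))"
      using H.commutator_eq_one_iff[OF c_car c_car] phi6_commute_iff[OF p] by simp
    also have "\<dots> \<longleftrightarrow> parallel p (f g) (f h)"
      unfolding f_def parallel_vec_mod ..
    finally show ?thesis .
  qed
  ultimately show thesis by (rule that)
qed

text \<open>The fibres of f are cosets of H, so each has \<open>card H\<close> elements.\<close>

lemma (in group) card_preimage_of_coset_map:
  assumes fin: "finite (carrier G)" and H: "subgroup H G"
    and surj: "S \<subseteq> f ` carrier G"
    and f: "\<And>g h. g \<in> carrier G \<Longrightarrow> h \<in> carrier G \<Longrightarrow> f g = f h \<longleftrightarrow> H #> g = H #> h"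
  shows "card {g \<in> carrier G. f g \<in> S} = card S * card H"
proof -
  have "card {g \<in> carrier G. f g = v} = card H" if "v \<in> S" for v
  proof -
    from that surj obtain h where h: "h \<in> carrier G" "v = f h" by blast
    have "{g \<in> carrier G. f g = v} = H #> h"
    proof (intro equalityI subsetI)
      fix g assume "g \<in> {g \<in> carrier G. f g = v}"
      then have "g \<in> carrier G" "H #> g = H #> h" using f h by auto
      then show "g \<in> H #> h" using rcos_self[OF _ H] by blast
    next
      fix g assume g: "g \<in> H #> h"
      then have "g \<in> carrier G"
        using r_coset_subset_G[OF subgroup.subset[OF H] h(1)] by blast
      moreover have "H #> h = H #> g"
        by (rule repr_independence[OF g h(1) H])
      ultimately show "g \<in> {g \<in> carrier G. f g = v}" using f h by simp
    qed
    moreover have "H #> h \<in> rcosets H"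
      using h by (auto simp: RCOSETS_def)
    ultimately show ?thesis
      using card_cosets_equal[OF _ subgroup.subset[OF H]] bij_betw_same_card by metis
  qed
  moreover have "{g \<in> carrier G. f g \<in> S} = (\<Union>v\<in>S. {g \<in> carrier G. f g = v})"
    by blast
  moreover have "finite S"
    using finite_subset[OF surj] fin by blast
  ultimately show ?thesis
    using fin by (simp add: card_UN_disjoint disjoint_iff)
qed

theorem lemma5p5:
  fixes G :: "('a, 'b) monoid_scheme" and p m :: nat
  assumes "prime p" and "odd p"
    and "group G" and "order G = p ^ m"
    and "isoclinism_rank p G = 5"
    and "in_Phi6 p G"
  shows "A_series G oo (fps_const (1 / of_nat (order G)) * fps_X) =
           fps_const (1 - of_nat p powi (-3)) / (1 - fps_const (of_nat p powi (-2)) * fps_X)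
           + fps_const (of_nat p powi (-3)) / (1 - fps_X)
         \<and>
         B_series G oo (fps_const (1 / of_nat (order G)) * fps_X) =
           fps_const (- (of_nat p powi (-1)) - of_nat p powi (-2))
             / (1 - fps_const (of_nat p powi (-3)) * fps_X)
           + fps_const (1 + of_nat p powi (-1) + of_nat p powi (-2))
             / (1 - fps_const (of_nat p powi (-2)) * fps_X)"
proof -
  interpret group G by fact
  have p0: "p > 0" using \<open>prime p\<close> by (rule prime_gt_0_nat)
  have fin: "finite (carrier G)"
    using \<open>order G = p ^ m\<close> p0 by (simp add: order_gt_0_iff_finite[symmetric])
  have "isoclinic G (phi6_1_5 p)"
    using \<open>in_Phi6 p G\<close> by (simp add: in_Phi6_def)
  then obtain f where surj: "f ` carrier G = vecs p"
    and coset: "\<And>g h. g \<in> carrier G \<Longrightarrow> h \<in> carrier G \<Longrightarrow> f g = f h \<longleftrightarrow> center G #>\<^bsub>G\<^esub> g = center G #>\<^bsub>G\<^esub> h"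
    and commute: "\<And>g h. g \<in> carrier G \<Longrightarrow> h \<in> carrier G \<Longrightarrow>
      g \<otimes>\<^bsub>G\<^esub> h = h \<otimes>\<^bsub>G\<^esub> g \<longleftrightarrow> parallel p (f g) (f h)"
    using isoclinic_phi6_vec[OF \<open>group G\<close> \<open>odd p\<close>] by blast
  have count: "card {g \<in> carrier G. f g \<in> S} = card S * card (center G)" if "S \<subseteq> vecs p" for S
    using card_preimage_of_coset_map[OF fin subgroup_center _ coset] that surj by simp
  have f_vecs: "f g \<in> vecs p" if "g \<in> carrier G" for g
    using that surj by blast
  have nonzero: "f g \<noteq> (0, 0, 0)" if g: "g \<in> carrier G - center G" for g
  proof
    \<comment> \<open>The zero vector is parallel to every vector, so g would commute with all of
      G.\<close>
    assume "f g = (0, 0, 0)"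
    then have "parallel p (f g) v" for v
      by (cases v) simp
    then have "g \<in> center G"
      using g commute unfolding center_iff by simp
    with g show False by simp
  qed
  have "{g \<in> carrier G. f g \<in> vecs p} = carrier G"
      using f_vecs by blast
  then have ord: "order G = p ^ 3 * card (center G)"
      using count[of "vecs p"] by (simp add: order_def card_vecs)
    have cent: "card (centralizer G g) = p * card (center G)" if g: "g \<in> carrier G - center G" for g
    proof -
      \<comment> \<open>The centralizer is the preimage of the line through the nonzero vector
        \<open>f g\<close>: p points, each with a fibre as large as the center.\<close>
      have "centralizer G g = {h \<in> carrier G. f h \<in> {w \<in> vecs p. parallel p (f g) w}}"
        using g commute f_vecs by (auto simp: centralizer_def)
      then show ?thesis
        using count[of "{w \<in> vecs p. parallel p (f g) w}"] g
        by (simp add: card_parallel[OF \<open>prime p\<close>] f_vecs nonzero)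
    qed
    have abel: "x \<otimes>\<^bsub>G\<^esub> y = y \<otimes>\<^bsub>G\<^esub> x"
      if g: "g \<in> carrier G - center G" and x: "x \<in> centralizer G g" and y: "y \<in> centralizer G g" for g x y
    proof -
      have xy: "x \<in> carrier G" "y \<in> carrier G"
        using x y by (simp_all add: centralizer_def)
      \<comment> \<open>The vectors of x and y lie on the line through \<open>f g\<close>, hence are
        parallel to each other.\<close>
      have "\<not> vec_cong p (f g) (0, 0, 0)"
        using nonzero[OF g] f_vecs[of g] g p0
        unfolding vec_mod_eq_iff[symmetric] by (simp add: vec_mod_id)
      moreover have "parallel p (f g) (f x)" "parallel p (f g) (f y)"
        using g x y commute by (auto simp: centralizer_def)
      ultimately show ?thesis
        using parallel_trans[OF \<open>prime p\<close>] commute[OF xy] by blast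
    qed
  show ?thesis
    by (intro conjI series_of_abelian_centralizers[OF fin p0 ord]; (assumption | rule cent abel)+)
qed

end
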